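(* Let $d\ge1$. The Fourier multiplier $T_\tau$ having symbol $\tau(\xi)=e^{\pi i t|\xi|^2}$, $\xi\in\mathbb{R}^d$ (where $t\in\mathbb{R}$ is the fixed time variable), is unbounded on every $W(\mathcal{F}L^p,L^q)(\mathbb{R}^d)$, $1\leq p,q\leq\infty$, with $p\neq q$; that is, there is no constant $C>0$ such that $\|T_\tau f\|_{W(\mathcal{F}L^p,L^q)}\le C\|f\|_{W(\mathcal{F}L^p,L^q)}$ for all $f\in\mathcal{S}(\mathbb{R}^d)$.
   Context: Fourier transform: $\hat f(\xi)=\int_{\mathbb{R}^d} f(y)e^{-2\pi i y\xi}\,dy$. The Fourier multiplier with symbol $\tau$ is $T_\tau f(x)=\int_{\mathbb{R}^d} e^{2\pi i x\xi}\tau(\xi)\hat f(\xi)\,d\xi$, $f\in\mathcal{S}(\mathbb{R}^d)$, where $\mathcal{S}(\mathbb{R}^d)$ is the Schwartz class. Short-time Fourier transform: for a fixed non-zero $g\in\mathcal{S}(\mathbb{R}^d)$, $V_gf(z,\zeta)=\int e^{-2\pi i\zeta y}f(y)\overline{g(y-z)}\,dy$. Wiener amalgam space: for $1\le p,q\le\infty$, $W(\mathcal{F}L^p,L^q)(\mathbb{R}^d)$ is the closure of $\mathcal{S}(\mathbb{R}^d)$ with respect to the norm $$\|f\|_{W(\mathcal{F}L^p,L^q)}=\Big(\int_{\mathbb{R}^d}\Big(\int_{\mathbb{R}^d}|V_gf(z,\zeta)|^p\,d\zeta\Big)^{q/p}\,dz\Big)^{1/q}$$ (with the obvious modifications if $p=\infty$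 or $q=\infty$); the definition is independent of the window $g$.
   Formalization: The time t is assumed nonzero: for t = 0 the symbol is identically 1, the multiplier is the identity on the Schwartz class, and the claimed unboundedness fails (C = 1 works). *)

theory Defs
  imports "HOL-Analysis.Analysis" "HOL-Probability.Essential_Supremum"
begin

definition partial_deriv :: "'n::finite \<Rightarrow> (real^'n \<Rightarrow> complex) \<Rightarrow> real^'n \<Rightarrow> complex" where
  "partial_deriv i f x = frechet_derivative f (at x) (axis i 1)"

(* Iterated partial derivatives are indexed by lists of coordinate directions. All orders of
   differentiation occur, so no symmetry of mixed derivatives is needed to cover every
   multi-index. *)
fun iter_partial_deriv :: "'n::finite list \<Rightarrow> (real^'n \<Rightarrow> complex) \<Rightarrow> real^'n \<Rightarrow> complex" where
  "iter_partial_deriv [] f = f"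
| "iter_partial_deriv (i # is) f = partial_deriv i (iter_partial_deriv is f)"

definition smooth :: "(real^'n::finite \<Rightarrow> complex) \<Rightarrow> bool" where
  "smooth f \<longleftrightarrow> (\<forall>is x. iter_partial_deriv is f differentiable (at x))"

definition schwartz_class :: "(real^'n::finite \<Rightarrow> complex) set" where
  "schwartz_class = {f. smooth f \<and>
     (\<forall>(\<alpha> :: 'n \<Rightarrow> nat) is. \<exists>B::real. \<forall>x.
        norm (of_real (\<Prod>i\<in>UNIV. (x $ i) ^ \<alpha> i) * iter_partial_deriv is f x) \<le> B)}"

definition fourier_transform :: "(real^'n::finite \<Rightarrow> complex) \<Rightarrow> real^'n \<Rightarrow> complex" where
  "fourier_transform f \<xi> = (LINT y|lborel. f y * exp (- (2 * of_real pi * \<i> * of_real (y \<bullet> \<xi>))))"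

definition fourier_multiplier ::
    "(real^'n::finite \<Rightarrow> complex) \<Rightarrow> (real^'n \<Rightarrow> complex) \<Rightarrow> real^'n \<Rightarrow> complex" where
  "fourier_multiplier \<tau> f x =
     (LINT \<xi>|lborel. exp (2 * of_real pi * \<i> * of_real (x \<bullet> \<xi>)) * \<tau> \<xi> * fourier_transform f \<xi>)"

definition stft ::
    "(real^'n::finite \<Rightarrow> complex) \<Rightarrow> (real^'n \<Rightarrow> complex) \<Rightarrow> real^'n \<Rightarrow> real^'n \<Rightarrow> complex" where
  "stft g f z \<zeta> =
     (LINT y|lborel. exp (- (2 * of_real pi * \<i> * of_real (\<zeta> \<bullet> y))) * f y * cnj (g (y - z)))"

(* The value 0 powr r is 0 in the library, which is the intended value for the exponents r > 0
   used below. *)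
definition ennreal_powr :: "ennreal \<Rightarrow> real \<Rightarrow> ennreal" where
  "ennreal_powr x r = (if x = \<infinity> then \<infinity> else ennreal (enn2real x powr r))"

definition Lp_norm :: "ennreal \<Rightarrow> (real^'n::finite \<Rightarrow> ennreal) \<Rightarrow> ennreal" where
  "Lp_norm p F = (if p = \<infinity> then esssup lborel F
     else ennreal_powr (\<integral>\<^sup>+x. ennreal_powr (F x) (enn2real p) \<partial>lborel) (1 / enn2real p))"

(* The norm of W(FL^p, L^q) computed with the window g: an L^p norm in the frequency variable,
   followed by an L^q norm in the time variable. *)
definition wiener_amalgam_norm ::
    "(real^'n::finite \<Rightarrow> complex) \<Rightarrow> ennreal \<Rightarrow> ennreal \<Rightarrow> (real^'n \<Rightarrow> complex) \<Rightarrow> ennreal" where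
  "wiener_amalgam_norm g p q f =
     Lp_norm q (\<lambda>z. Lp_norm p (\<lambda>\<zeta>. ennreal (norm (stft g f z \<zeta>))))"

end

theory Submission
  imports Defs "HOL-Probability.Characteristic_Functions" "HOL-Probability.Sinc_Integral"
begin

text \<open>
  On the time-frequency plane the multiplier acts as the shear \<open>(z, \<zeta>) \<mapsto> (z - t \<zeta>, \<zeta>)\<close>. Take a sum of
  \<open>K\<close> time-frequency shifts of the window \<open>g\<close> by far apart frequencies \<open>\<eta>\<^sub>k = k N e\<close>, \<open>k < K\<close>.
  If all pieces sit over the same time, the norm in \<open>\<zeta>\<close> sees \<open>K\<close> separate bumps and the amalgam norm is
  of order \<open>K powr (1 / p)\<close>; if they sit over separate times, it is of order \<open>K powr (1 / q)\<close>. The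
  multiplier carries pure modulations (the first situation) to the second one, and shifts by
  \<open>(t \<eta>\<^sub>k, \<eta>\<^sub>k)\<close> (the second situation) to the first one. Letting \<open>K \<rightarrow> \<infinity>\<close> excludes boundedness
  for \<open>q < p\<close> in the one way and for \<open>p < q\<close> in the other.
\<close>

subsection \<open>Characters and polynomial weights\<close>

text \<open>The window \<open>g\<close> is an arbitrary non-zero Schwartz function, so the
  transformed pieces have no explicit formula. Upper bounds use only that \<open>stft g g\<close> is
  dominated by a product of a function of time and a function of frequency, which allows the mixed
  norm to be estimated one variable at a time. Lower bounds use only that the transformed window has
  a short-time transform bounded away from 0 on some product of balls; this rests on continuity and
  on injectivity of the Fourier transform, applied twice. The pieces are never truly disjoint, so
  the spacing \<open>N\<close> must grow with \<open>K\<close>: the other pieces, each of size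
  O(1/N), must together stay below the main one, and overlap sums must stay bounded independently of
  \<open>K\<close>. Infinite exponents raise one issue: an outer essential supremum requires the
  inner norm to be measurable in \<open>z\<close>. If \<open>q < p\<close>, the outer exponent is
  finite; if \<open>p < q\<close>, the inner norm is a power of an integral and hence
  measurable.\<close>

definition ch :: "real \<Rightarrow> complex" where
  "ch x = cis (2 * pi * x)"

lemma ch_0 [simp]: "ch 0 = 1"
  by (simp add: ch_def)

lemma ch_add: "ch (a + b) = ch a * ch b"
  by (simp add: ch_def cis_mult distrib_left)

lemma cnj_ch: "cnj (ch a) = ch (- a)"
  by (simp add: ch_def cis_cnj)

lemma norm_ch [simp]: "norm (ch a) = 1"
  by (simp add: ch_def)

lemma exp_eq_ch: "exp (2 * of_real pi * \<i> * of_real a) = ch a"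
  by (simp add: ch_def cis_conv_exp mult_ac)

lemma exp_minus_eq_ch: "exp (- (2 * of_real pi * \<i> * of_real a)) = ch (- a)"
  by (simp flip: exp_eq_ch)

lemma ch_has_vector_derivative: "(ch has_vector_derivative 2 * pi * \<i> * ch x) (at x)"
proof -
  have "((\<lambda>x. exp (of_real x * (2 * of_real pi * \<i>))) has_vector_derivative
     exp (of_real x * (2 * of_real pi * \<i>)) * (2 * of_real pi * \<i>)) (at x)"
    by (rule has_vector_derivative_real_field) (auto intro!: derivative_eq_intros)
  then show ?thesis
    by (simp add: ch_def [abs_def] cis_conv_exp mult_ac)
qed

lemma continuous_on_ch [continuous_intros]:
  "continuous_on S f \<Longrightarrow> continuous_on S (\<lambda>x. ch (f x))"
  unfolding ch_def by (intro continuous_intros)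

lemma borel_measurable_ch [measurable]: "ch \<in> borel_measurable borel"
  by (rule borel_measurable_continuous_onI) (intro continuous_intros)

text \<open>A product over the coordinates rather than a power of 1 + |x|^2: the integral of its
  reciprocal factorizes into one-dimensional integrals, so a single power is integrable in every
  dimension.\<close>

definition weight :: "real^'n::finite \<Rightarrow> real" where
  "weight x = (\<Prod>i\<in>UNIV. 1 + (x $ i)\<^sup>2)"

definition decay :: "real^'n::finite \<Rightarrow> real" where
  "decay x = inverse (weight x)"

lemma weight_ge_1: "1 \<le> weight x"
  unfolding weight_def by (rule prod_ge_1) auto

lemma weight_pos [simp]: "0 < weight x"
  using weight_ge_1[of x] by linarith

lemma decay_pos [simp]: "0 < decay x"
  by (simp add: decay_def)

lemma decay_nonneg [simp]: "0 \<le> decay x"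
  by (simp add: less_imp_le)

lemma decay_le_1: "decay x \<le> 1"
  using weight_ge_1[of x] by (simp add: decay_def inverse_le_1_iff)

lemma weight_minus [simp]: "weight (- x) = weight x"
  by (simp add: weight_def)

lemma decay_minus [simp]: "decay (- x) = decay x"
  by (simp add: decay_def)

lemma weight_ge_component: "1 + (x $ i)\<^sup>2 \<le> weight x"
proof -
  have "1 \<le> (\<Prod>j\<in>UNIV - {i}. 1 + (x $ j)\<^sup>2)"
    by (rule prod_ge_1) auto
  then have "(1 + (x $ i)\<^sup>2) * 1 \<le> (1 + (x $ i)\<^sup>2) * (\<Prod>j\<in>UNIV - {i}. 1 + (x $ j)\<^sup>2)"
    by (intro mult_left_mono) auto
  also have "\<dots> = weight x"
    unfolding weight_def by (rule prod.remove[symmetric]) auto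
  finally show ?thesis by simp
qed

lemma decay_le_component: "decay x \<le> 1 / (1 + (x $ i)\<^sup>2)"
  unfolding decay_def inverse_eq_divide
  by (rule divide_left_mono) (auto simp: weight_ge_component intro!: mult_pos_pos add_pos_nonneg)

text \<open>Peetre's inequality in product form, proved coordinatewise. It trades decay around one
  centre for decay around another at a constant cost.\<close>

lemma weight_add_le:
  fixes x y :: "real^'n::finite"
  shows "weight (x + y) \<le> 2 ^ CARD('n) * weight x * weight y"
proof -
  have "1 + (a + b)\<^sup>2 \<le> 2 * (1 + a\<^sup>2) * (1 + b\<^sup>2)" for a b :: real
  proof -
    have "2 * (1 + a\<^sup>2) * (1 + b\<^sup>2) - (1 + (a + b)\<^sup>2) = 1 + (a - b)\<^sup>2 + 2 * (a * b)\<^sup>2"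
      by (simp add: power2_eq_square algebra_simps)
    then show ?thesis
      by (smt (verit) zero_le_power2)
  qed
  then have "weight (x + y) \<le> (\<Prod>i\<in>UNIV. 2 * (1 + (x $ i)\<^sup>2) * (1 + (y $ i)\<^sup>2))"
    unfolding weight_def by (intro prod_mono) auto
  also have "\<dots> = 2 ^ CARD('n) * weight x * weight y"
    by (simp only: weight_def prod.distrib prod_constant)
  finally show ?thesis .
qed

lemma decay_mult_le:
  fixes x y :: "real^'n::finite"
  shows "decay x * decay y \<le> 2 ^ CARD('n) * decay (x + y)"
  using weight_add_le[of x y]
  by (simp add: decay_def field_simps)

lemma decay_le_weight_mult:
  fixes x y :: "real^'n::finite"
  shows "decay x \<le> 2 ^ CARD('n) * weight y * decay (x + y)"
  using decay_mult_le[of x y] by (simp add: decay_def field_simps)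

lemma continuous_on_decay [continuous_intros]:
  "continuous_on S f \<Longrightarrow> continuous_on S (\<lambda>x. decay (f x))"
  unfolding decay_def weight_def
  by (intro continuous_intros) (auto simp: add_nonneg_eq_0_iff)

lemma borel_measurable_decay [measurable]: "decay \<in> borel_measurable borel"
  by (rule borel_measurable_continuous_onI) (intro continuous_intros)

lemma Basis_vec_real: "(Basis :: (real^'n::finite) set) = range (\<lambda>i. axis i 1)"
  by (auto simp: Basis_vec_def)

lemma inj_axis_1: "inj (\<lambda>i::'n::finite. axis i (1::real))"
  by (auto simp: inj_def axis_eq_axis)

lemma prod_Basis_vec: "(\<Prod>b\<in>(Basis :: (real^'n::finite) set). f b) = (\<Prod>i\<in>UNIV. f (axis i 1))"
  unfolding Basis_vec_real by (subst prod.reindex[OF inj_axis_1]) simp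

lemma integrable_decay: "integrable lborel (decay :: real^'n::finite \<Rightarrow> real)"
proof (rule integrableI_nonneg)
  have "set_integrable lborel UNIV (\<lambda>x::real. inverse (1 + x^2))"
    using integrable_inverse_1_plus_square by simp
  then have fin: "(\<integral>\<^sup>+x. ennreal (inverse (1 + x^2)) \<partial>lborel) < \<infinity>"
    by (auto simp: set_integrable_def integrable_iff_bounded add_nonneg_nonneg)
  have "decay x = (\<Prod>b\<in>Basis. inverse (1 + (x \<bullet> b)\<^sup>2))" for x :: "real^'n"
    by (simp add: decay_def weight_def prod_Basis_vec inner_axis flip: prod_inversef)
  then have "(\<integral>\<^sup>+x. ennreal (decay (x::real^'n)) \<partial>lborel)
      = (\<integral>\<^sup>+x. (\<Prod>b\<in>Basis. ennreal (inverse (1 + ((x::real^'n) \<bullet> b)\<^sup>2))) \<partial>lborel)"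
    by (intro nn_integral_cong) (simp add: prod_ennreal add_nonneg_nonneg)
  also have "\<dots> = (\<Prod>b\<in>(Basis::(real^'n) set). (\<integral>\<^sup>+x. ennreal (inverse (1 + x^2)) \<partial>lborel))"
    by (rule nn_integral_lborel_prod) auto
  also have "\<dots> < \<infinity>"
    using fin by (simp add: power_less_top_ennreal)
  finally show "(\<integral>\<^sup>+x. ennreal (decay (x::real^'n)) \<partial>lborel) < \<infinity>" .
qed auto

section \<open>Translation invariance of Lebesgue integrals\<close>

lemma lborel_integral_translate:
  fixes f :: "'a::euclidean_space \<Rightarrow> 'b::{banach, second_countable_topology}"
  shows "(LINT x|lborel. f (x + c)) = (LINT x|lborel. f x)"
proof -
  show ?thesis
  proof (cases "f \<in> borel_measurable borel")
    case True
    have "(LINT x|lborel. f x) = (LINT x|distr lborel borel ((+) c). f x)"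
      by (simp add: lborel_distr_plus)
    also have "\<dots> = (LINT x|lborel. f (c + x))"
      using True by (intro integral_distr) auto
    finally show ?thesis by (simp add: add.commute)
  next
    \<comment> \<open>Measurability is itself translation invariant, so here both integrals take the
      default value 0. This keeps the later shift formulas free of hypotheses.\<close>
    case False
    have "(\<lambda>x. f (x + c)) \<notin> borel_measurable borel"
    proof
      assume "(\<lambda>x. f (x + c)) \<in> borel_measurable borel"
      then have "(\<lambda>x. f (x - c + c)) \<in> borel_measurable borel"
        by (rule measurable_compose[rotated]) simp
      with False show False by simp
    qed
    with False show ?thesis
      by (simp add: not_integrable_integral_eq borel_measurable_integrable integrable_iff_bounded)
  qed
qed

lemma lborel_integrable_translate:
  fixes f :: "'a::euclidean_space \<Rightarrow> 'b::{banach, second_countable_topology}"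
  assumes "integrable lborel f"
  shows "integrable lborel (\<lambda>x. f (x + c))"
proof -
  have "integrable (distr lborel borel ((+) c)) f"
    using assms by (simp add: lborel_distr_plus)
  then have "integrable lborel (\<lambda>x. f (c + x))"
    by (subst (asm) integrable_distr_eq) (use assms in auto)
  then show ?thesis by (simp add: add.commute)
qed

subsection \<open>Integration by parts for the Fourier transform\<close>

lemma ch_has_derivative [derivative_intros]:
  assumes "(f has_derivative f') (at x within S)"
  shows "((\<lambda>x. ch (f x)) has_derivative (\<lambda>h. f' h *\<^sub>R (2 * pi * \<i> * ch (f x)))) (at x within S)"
  by (rule has_derivative_compose[OF assms, unfolded o_def])
     (use ch_has_vector_derivative[of "f x"] in \<open>simp add: has_vector_derivative_def\<close>)

lemma partial_deriv_eq:
  "(f has_derivative D) (at x) \<Longrightarrow> partial_deriv i f x = D (axis i 1)"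
  unfolding partial_deriv_def by (simp flip: frechet_derivative_at)

lemma has_vector_derivative_along_axis:
  assumes "f differentiable (at (x + \<theta> *\<^sub>R axis i 1))"
  shows "((\<lambda>s. f (x + s *\<^sub>R axis i 1)) has_vector_derivative
     partial_deriv i f (x + \<theta> *\<^sub>R axis i 1)) (at \<theta> within S)"
proof -
  let ?D = "frechet_derivative f (at (x + \<theta> *\<^sub>R axis i 1))"
  have D: "(f has_derivative ?D) (at (x + \<theta> *\<^sub>R axis i 1))"
    using assms by (simp add: frechet_derivative_works)
  have "((\<lambda>s. f (x + s *\<^sub>R axis i 1)) has_derivative (\<lambda>h. ?D (h *\<^sub>R axis i 1))) (at \<theta> within S)"
    by (rule has_derivative_compose[where f="\<lambda>s. x + s *\<^sub>R axis i 1" and g=f, OF _ D]) (auto intro!: derivative_eq_intros)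
  then show ?thesis
    by (simp add: has_vector_derivative_def partial_deriv_def
        linear_cmul[OF has_derivative_linear[OF D]])
qed

lemma continuous_on_if_differentiable:
  "(\<And>x. f differentiable (at x)) \<Longrightarrow> continuous_on S f"
  by (meson continuous_at_imp_continuous_on differentiable_imp_continuous_within)

lemma measurable_if_differentiable:
  fixes f :: "'a::real_normed_vector \<Rightarrow> 'b::real_normed_vector"
  shows "(\<And>x. f differentiable (at x)) \<Longrightarrow> f \<in> borel_measurable borel"
  by (intro borel_measurable_continuous_onI continuous_on_if_differentiable)

lemma integrable_if_decay:
  fixes f :: "real^'n::finite \<Rightarrow> complex"
  assumes "f \<in> borel_measurable borel" "\<And>x. norm (f x) \<le> C * decay x"
  shows "integrable lborel f"
proof (rule Bochner_Integration.integrable_bound)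
  show "integrable lborel (\<lambda>x::real^'n. C * decay x)"
    by (intro integrable_mult_right integrable_decay)
  show "AE x in lborel. norm (f x) \<le> norm (C * decay x)"
    using assms(2) by (auto intro: order_trans[OF _ abs_ge_self])
qed (use assms(1) in auto)

text \<open>The integral of a difference quotient vanishes by translation invariance.\<close>
lemma integral_partial_deriv_eq_0:
  fixes w :: "real^'n::finite \<Rightarrow> complex"
  assumes diff: "\<And>x. w differentiable (at x)"
    and w: "\<And>x. norm (w x) \<le> C * decay x"
    and w': "\<And>x. norm (partial_deriv i w x) \<le> C' * decay x"
    and meas: "partial_deriv i w \<in> borel_measurable borel"
  shows "(LINT x|lborel. partial_deriv i w x) = 0"
proof -
  define e where "e = (axis i 1 :: real^'n)"
  define s where "s n = inverse (real (Suc n))" for n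
  define D where "D n x = (w (x + s n *\<^sub>R e) - w x) /\<^sub>R s n" for n x
  have s: "0 < s n" "s n \<le> 1" for n
    by (auto simp: s_def inverse_le_1_iff)
  have s0: "s \<longlonglongrightarrow> 0"
    unfolding s_def by (rule LIMSEQ_inverse_real_of_nat)
  have wm [measurable]: "w \<in> borel_measurable borel"
    by (intro measurable_if_differentiable diff)
  have iw: "integrable lborel w"
    using w by (intro integrable_if_decay) auto
  have C': "0 \<le> C'"
  proof (rule ccontr)
    assume "\<not> 0 \<le> C'"
    then have "C' * decay (0::real^'n) < 0"
      by (simp add: mult_less_0_iff)
    with order_trans[OF norm_ge_zero w'[of 0]] show False
      by simp
  qed
  \<comment> \<open>Mean value inequality along the axis. Since the step is at most 1, the
    intermediate points are \<open>x + \<theta> *\<^sub>R e\<close> with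
    \<open>weight (- (\<theta> *\<^sub>R e))\<close> at most 2, so Peetre's inequality carries the
    decay back to \<open>x\<close> with the factor \<open>2 ^ CARD('n) * 2\<close>, uniformly in
    \<open>n\<close>.\<close>
  have bound: "norm (D n x) \<le> (C' * (2 ^ CARD('n) * 2)) * decay x" for n x
  proof -
    let ?B = "C' * (2 ^ CARD('n) * 2) * decay x"
    have "norm (w (x + s n *\<^sub>R e) - w (x + 0 *\<^sub>R e)) \<le> ?B * norm (s n - 0)"
    proof (rule differentiable_bound[where S="{0..s n}"
          and f'="\<lambda>\<theta> h. h *\<^sub>R partial_deriv i w (x + \<theta> *\<^sub>R e)"])
      fix \<theta> assume \<theta>: "\<theta> \<in> {0..s n}"
      show "((\<lambda>s. w (x + s *\<^sub>R e)) has_derivative (\<lambda>h. h *\<^sub>R partial_deriv i w (x + \<theta> *\<^sub>R e)))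
          (at \<theta> within {0..s n})"
        using has_vector_derivative_along_axis[where f=w and x=x and \<theta>=\<theta> and i=i, OF diff]
        by (simp add: has_vector_derivative_def e_def)
      have "weight (- (\<theta> *\<^sub>R e)) = (\<Prod>j\<in>UNIV. if j = i then 1 + \<theta>\<^sup>2 else 1)"
        unfolding weight_def by (rule prod.cong) (auto simp: e_def axis_def)
      also have "\<dots> \<le> 2"
        using \<theta> s(2)[of n] by (auto intro!: power_le_one)
      finally have "weight (- (\<theta> *\<^sub>R e)) \<le> 2" .
      then have "2 ^ CARD('n) * weight (- (\<theta> *\<^sub>R e)) * decay x \<le> 2 ^ CARD('n) * 2 * decay x"
        by (intro mult_right_mono mult_left_mono) auto
      with decay_le_weight_mult[of "x + \<theta> *\<^sub>R e" "- (\<theta> *\<^sub>R e)"]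
      have "decay (x + \<theta> *\<^sub>R e) \<le> 2 ^ CARD('n) * 2 * decay x"
        by (simp only: add_diff_cancel_right' flip: diff_conv_add_uminus)
      then have "C' * decay (x + \<theta> *\<^sub>R e) \<le> C' * (2 ^ CARD('n) * 2 * decay x)"
        using C' by (rule mult_left_mono)
      then have "norm (partial_deriv i w (x + \<theta> *\<^sub>R e)) \<le> ?B"
        using w'[of "x + \<theta> *\<^sub>R e"] by (simp add: mult.assoc)
      then show "onorm (\<lambda>h. h *\<^sub>R partial_deriv i w (x + \<theta> *\<^sub>R e)) \<le> ?B"
        by (intro onorm_le) (metis abs_ge_zero mult.commute mult_left_mono norm_scaleR real_norm_def)
    qed (use s in \<open>auto simp: less_imp_le\<close>)
    then have "norm (w (x + s n *\<^sub>R e) - w x) \<le> ?B * s n"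
      using s(1)[of n] by simp
    moreover have "w (x + s n *\<^sub>R e) - w x = s n *\<^sub>R D n x"
      using s(1)[of n] by (simp add: D_def)
    ultimately have "s n * norm (D n x) \<le> s n * ?B"
      using s(1)[of n] by (simp only: norm_scaleR real_norm_def abs_of_pos mult.commute[of _ "s n"])
    then show ?thesis
      using s(1)[of n] by (simp only: mult_le_cancel_left_pos)
  qed
  have lim: "(\<lambda>n. D n x) \<longlonglongrightarrow> partial_deriv i w x" for x
  proof -
    have "((\<lambda>s. w (x + s *\<^sub>R e)) has_vector_derivative partial_deriv i w x) (at 0)"
      using has_vector_derivative_along_axis[where f=w and x=x and \<theta>=0 and i=i, OF diff] by (simp add: e_def)
    then have "((\<lambda>h. norm (w (x + h *\<^sub>R e) - w x - h *\<^sub>R partial_deriv i w x) / norm h) \<longlongrightarrow> 0) (at 0)"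
      by (simp add: has_vector_derivative_def has_derivative_at)
    then have "((\<lambda>h. norm ((w (x + h *\<^sub>R e) - w x) /\<^sub>R h - partial_deriv i w x)) \<longlongrightarrow> 0) (at 0)"
    proof (rule Lim_transform_eventually)
      have "norm (a - h *\<^sub>R v) / norm h = norm (a /\<^sub>R h - v)" if "h \<noteq> 0" for a v :: complex and h :: real
      proof -
        have "a /\<^sub>R h - v = (a - h *\<^sub>R v) /\<^sub>R h"
          using that by (simp add: scaleR_diff_right)
        then show ?thesis by (simp add: divide_inverse mult.commute)
      qed
      then show "\<forall>\<^sub>F h in at 0. norm (w (x + h *\<^sub>R e) - w x - h *\<^sub>R partial_deriv i w x) / norm h
          = norm ((w (x + h *\<^sub>R e) - w x) /\<^sub>R h - partial_deriv i w x)"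
        unfolding eventually_at_filter by (intro always_eventually allI impI)
    qed
    then have "((\<lambda>h. (w (x + h *\<^sub>R e) - w x) /\<^sub>R h) \<longlongrightarrow> partial_deriv i w x) (at 0)"
      by (rule tendsto_norm_zero_cancel[THEN LIM_zero_cancel])
    moreover have "filterlim s (at 0) sequentially"
      using s0 s(1) by (auto simp: filterlim_at less_imp_neq[symmetric] intro!: always_eventually)
    ultimately show ?thesis
      unfolding D_def by (rule filterlim_compose)
  qed
  have "(\<lambda>n. LINT x|lborel. D n x) \<longlonglongrightarrow> (LINT x|lborel. partial_deriv i w x)"
  proof (rule integral_dominated_convergence)
    show "integrable lborel (\<lambda>x::real^'n. C' * (2 ^ CARD('n) * 2) * decay x)"
      by (intro integrable_mult_right integrable_decay)
    show "D n \<in> borel_measurable lborel" for n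
      unfolding D_def by measurable
  qed (use lim bound meas in auto)
  moreover have "(LINT x|lborel. D n x) = 0" for n
  proof -
    have "(LINT x|lborel. w (x + s n *\<^sub>R e) - w x) = 0"
      by (subst Bochner_Integration.integral_diff[OF lborel_integrable_translate[OF iw] iw])
         (simp only: lborel_integral_translate[of w] diff_self)
    then show ?thesis
      by (simp add: D_def)
  qed
  ultimately have "(\<lambda>n. 0) \<longlonglongrightarrow> (LINT x|lborel. partial_deriv i w x)"
    by simp
  then show ?thesis
    by (simp add: LIMSEQ_const_iff)
qed

lemma fourier_transform_eq: "fourier_transform f \<xi> = (LINT y|lborel. f y * ch (- (y \<bullet> \<xi>)))"
  by (simp add: fourier_transform_def exp_minus_eq_ch)

text \<open>The partial derivative of \<open>u\<close> times the character integrates to 0, and the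
  product rule splits it into the two transforms.\<close>

lemma fourier_transform_partial_deriv:
  fixes u :: "real^'n::finite \<Rightarrow> complex"
  assumes diff: "\<And>x. u differentiable (at x)"
    and u: "\<And>x. norm (u x) \<le> C * decay x"
    and u': "\<And>x. norm (partial_deriv i u x) \<le> C' * decay x"
    and meas [measurable]: "partial_deriv i u \<in> borel_measurable borel"
  shows "fourier_transform (partial_deriv i u) \<xi> = 2 * pi * \<i> * (\<xi> $ i) * fourier_transform u \<xi>"
proof -
  define w where "w y = u y * ch (- (y \<bullet> \<xi>))" for y
  have um [measurable]: "u \<in> borel_measurable borel"
    by (intro measurable_if_differentiable diff)
  have w_deriv: "(w has_derivative (\<lambda>h. u y * (- (h \<bullet> \<xi>) *\<^sub>R (2 * pi * \<i> * ch (- (y \<bullet> \<xi>))))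
      + frechet_derivative u (at y) h * ch (- (y \<bullet> \<xi>)))) (at y)" for y
    unfolding w_def
    using diff[of y] unfolding frechet_derivative_works
    by (auto intro!: derivative_eq_intros)
  have pd: "partial_deriv i w y = partial_deriv i u y * ch (- (y \<bullet> \<xi>))
      - 2 * pi * \<i> * (\<xi> $ i) * (u y * ch (- (y \<bullet> \<xi>)))" for y
    by (subst partial_deriv_eq[OF w_deriv])
       (simp add: partial_deriv_def inner_axis inner_commute[of "axis _ _"] scaleR_conv_of_real)
  have int: "integrable lborel (\<lambda>y. u y * ch (- (y \<bullet> \<xi>)))"
    "integrable lborel (\<lambda>y. partial_deriv i u y * ch (- (y \<bullet> \<xi>)))"
    by (rule integrable_if_decay; use u u' in \<open>auto simp: norm_mult\<close>)+
  have "(LINT y|lborel. partial_deriv i w y) = 0"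
  proof (rule integral_partial_deriv_eq_0)
    show "w differentiable (at y)" for y
      using w_deriv by (rule differentiableI)
    show "norm (w y) \<le> C * decay y" for y
      using u by (simp add: w_def norm_mult)
    show "norm (partial_deriv i w y) \<le> (C' + norm (2 * pi * \<i> * (\<xi> $ i)) * C) * decay y" for y
    proof -
      have "norm (partial_deriv i w y) \<le> norm (partial_deriv i u y)
          + norm (2 * pi * \<i> * (\<xi> $ i)) * norm (u y)"
        unfolding pd by (rule order_trans[OF norm_triangle_ineq4]) (simp add: norm_mult)
      also have "\<dots> \<le> C' * decay y + norm (2 * pi * \<i> * (\<xi> $ i)) * (C * decay y)"
        using u u' by (intro add_mono mult_left_mono) auto
      finally show ?thesis by (simp add: algebra_simps)
    qed
    show "partial_deriv i w \<in> borel_measurable borel"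
      unfolding pd [abs_def] by measurable
  qed
  then show ?thesis
    using int by (simp add: pd fourier_transform_eq)
qed

lemma norm_fourier_transform_le:
  fixes u :: "real^'n::finite \<Rightarrow> complex"
  assumes [measurable]: "u \<in> borel_measurable borel" and "\<And>x. norm (u x) \<le> C * decay x"
  shows "norm (fourier_transform u \<xi>) \<le> C * (LINT x|lborel. decay (x::real^'n))"
proof -
  have "norm (fourier_transform u \<xi>) \<le> (LINT x|lborel. norm (u x * ch (- (x \<bullet> \<xi>))))"
    unfolding fourier_transform_eq by (rule integral_norm_bound)
  also have "\<dots> \<le> (LINT x|lborel. C * decay (x::real^'n))"
    using assms integrable_if_decay[OF assms]
    by (intro integral_mono) (auto simp: norm_mult intro!: integrable_decay integrable_mult_right)
  finally show ?thesis by simp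
qed

text \<open>A decay estimate for a function on frequency space reduces to bounds for finitely many
  monomials, namely those with exponents \<open>0\<close> and \<open>2\<close>.\<close>
lemma decay_if_monomials_bounded:
  fixes F :: "'a \<Rightarrow> real^'n::finite \<Rightarrow> complex" and A :: "'a \<Rightarrow> real"
  assumes bound: "\<And>is. \<exists>C. \<forall>z \<xi>. norm (F z \<xi>) * (\<Prod>i\<leftarrow>is. \<bar>2 * pi * \<xi> $ i\<bar>) \<le> C * A z"
    and A: "\<And>z. 0 \<le> A z"
  shows "\<exists>C>0. \<forall>z \<xi>. norm (F z \<xi>) \<le> C * A z * decay \<xi>"
proof -
  from bound obtain C where C: "norm (F z \<xi>) * (\<Prod>i\<leftarrow>is. \<bar>2 * pi * \<xi> $ i\<bar>) \<le> C is * A z" for "is" z \<xi>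
    by metis
  \<comment> \<open>\<open>L S\<close> lists each element of \<open>S\<close> twice, so its monomial
    is a product of squares over \<open>S\<close>. Only finitely many sets \<open>S\<close> occur,
    hence a single constant \<open>K\<close> serves all of them.\<close>
  define l where "l S = (SOME is. set is = S \<and> distinct is)" for S :: "'n set"
  have l: "set (l S) = S" "distinct (l S)" for S
    using someI_ex[OF finite_distinct_list[of S]] by (auto simp: l_def)
  define L where "L S = l S @ l S" for S
  define K where "K = 1 + (\<Sum>S\<in>UNIV. \<bar>C (L S)\<bar>)"
  have K: "C (L S) \<le> K" "0 < K" for S
  proof -
    have "\<bar>C (L S)\<bar> \<le> (\<Sum>S\<in>UNIV. \<bar>C (L S)\<bar>)"
      by (rule member_le_sum) auto
    then show "C (L S) \<le> K" by (simp add: K_def)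
    show "0 < K" unfolding K_def by (intro add_pos_nonneg sum_nonneg) auto
  qed
  have "norm (F z \<xi>) \<le> (2 ^ CARD('n) * K) * A z * decay \<xi>" for z \<xi>
  proof -
    \<comment> \<open>The monomial is chosen according to the point: for a coordinate v of modulus
      at least 1, (1 + v^2)/2 is at most v^2 and so at most (2 pi v)^2; for the others it is at most
      1. The halves account for \<open>2 ^ CARD('n)\<close>.\<close>
    define S where "S = {i. 1 \<le> \<bar>\<xi> $ i\<bar>}"
    have "(\<Prod>i\<leftarrow>L S. \<bar>2 * pi * \<xi> $ i\<bar>) = (\<Prod>i\<in>S. \<bar>2 * pi * \<xi> $ i\<bar> ^ 2)"
      using prod.distinct_set_conv_list[OF l(2), of "\<lambda>i. \<bar>2 * pi * \<xi> $ i\<bar>" S]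
      by (simp only: L_def l(1) power2_eq_square prod.distrib map_append prod_list.append)
    also have "\<dots> = (\<Prod>i\<in>UNIV. if i \<in> S then \<bar>2 * pi * \<xi> $ i\<bar> ^ 2 else 1)"
      by (simp add: prod.If_cases)
    also have "\<dots> \<ge> (\<Prod>i\<in>UNIV. (1 + (\<xi> $ i)\<^sup>2) / 2)"
    proof (rule prod_mono)
      fix i
      have "(1 + (\<xi> $ i)\<^sup>2) / 2 \<le> \<bar>2 * pi * \<xi> $ i\<bar>\<^sup>2" if "1 \<le> \<bar>\<xi> $ i\<bar>"
      proof -
        have "1 * 1 \<le> (2 * pi) * (2 * pi)"
          using pi_ge_two by (intro mult_mono) auto
        then have "1 \<le> (2 * pi)\<^sup>2"
          by (simp only: power2_eq_square mult_1)
        then have "1 * (\<xi> $ i)\<^sup>2 \<le> (2 * pi)\<^sup>2 * (\<xi> $ i)\<^sup>2"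
          by (rule mult_right_mono) auto
        moreover have "1 \<le> (\<xi> $ i)\<^sup>2"
          using that power_mono[of 1 "\<bar>\<xi> $ i\<bar>" 2] by simp
        ultimately show ?thesis
          by (simp only: power2_abs power_mult_distrib[of "2 * pi"]) simp
      qed
      moreover have "(1 + (\<xi> $ i)\<^sup>2) / 2 \<le> 1" if "\<not> 1 \<le> \<bar>\<xi> $ i\<bar>"
        using that by (simp add: abs_square_le_1)
      ultimately show "0 \<le> (1 + (\<xi> $ i)\<^sup>2) / 2 \<and> (1 + (\<xi> $ i)\<^sup>2) / 2 \<le> (if i \<in> S then \<bar>2 * pi * \<xi> $ i\<bar>\<^sup>2 else 1)"
        unfolding S_def by (simp only: mem_Collect_eq split: if_split) simp
    qed
    finally have "weight \<xi> / 2 ^ CARD('n) \<le> (\<Prod>i\<leftarrow>L S. \<bar>2 * pi * \<xi> $ i\<bar>)"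
      by (simp add: prod_dividef weight_def)
    then have "norm (F z \<xi>) * (weight \<xi> / 2 ^ CARD('n)) \<le> norm (F z \<xi>) * (\<Prod>i\<leftarrow>L S. \<bar>2 * pi * \<xi> $ i\<bar>)"
      by (rule mult_left_mono) simp
    also have "\<dots> \<le> C (L S) * A z"
      by (rule C)
    also have "\<dots> \<le> K * A z"
      using K A by (intro mult_right_mono) auto
    finally have "norm (F z \<xi>) * weight \<xi> \<le> 2 ^ CARD('n) * K * A z"
      by (simp add: field_simps)
    then have "norm (F z \<xi>) \<le> 2 ^ CARD('n) * K * A z / weight \<xi>"
      by (simp only: pos_le_divide_eq[OF weight_pos])
    then show ?thesis
      by (simp only: decay_def divide_inverse)
  qed
  moreover have "0 < 2 ^ CARD('n) * K"
    using K(2) by simp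
  ultimately show ?thesis
    by blast
qed

subsection \<open>Schwartz functions\<close>

lemma schwartz_differentiable:
  "g \<in> schwartz_class \<Longrightarrow> iter_partial_deriv is g differentiable (at x)"
  by (simp add: schwartz_class_def smooth_def)

text \<open>For each coordinate v, 1 + v^2 is at most 2 v^2 or at most 2, according to whether |v|
  is at least 1. So \<open>weight x ^ m\<close> is controlled by a monomial that depends only on
  which coordinates are large, and there are finitely many of these.\<close>

lemma schwartz_weight_bounded:
  fixes g :: "real^'n::finite \<Rightarrow> complex"
  assumes "g \<in> schwartz_class"
  shows "\<exists>C. \<forall>x. norm (iter_partial_deriv is g x) * weight x ^ m \<le> C"
proof -
  have "\<forall>\<alpha> :: 'n \<Rightarrow> nat. \<exists>B::real. \<forall>x.
      norm (of_real (\<Prod>i\<in>UNIV. (x $ i) ^ \<alpha> i) * iter_partial_deriv is g x) \<le> B"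
    using assms by (simp add: schwartz_class_def)
  then obtain B where B: "norm (of_real (\<Prod>i\<in>UNIV. (x $ i) ^ \<alpha> i) * iter_partial_deriv is g x) \<le> B \<alpha>"
    for \<alpha> x by metis
  define \<alpha> where "\<alpha> S i = (if i \<in> S then 2 * m else 0)" for S :: "'n set" and i
  define K where "K = (\<Sum>S\<in>UNIV. \<bar>B (\<alpha> S)\<bar>)"
  have "norm (iter_partial_deriv is g x) * weight x ^ m \<le> (2 ^ m) ^ CARD('n) * K" for x
  proof -
    define S where "S = {i. 1 \<le> \<bar>x $ i\<bar>}"
    have "weight x ^ m = (\<Prod>i\<in>UNIV. (1 + (x $ i)\<^sup>2) ^ m)"
      by (simp add: weight_def prod_power_distrib)
    also have "\<dots> \<le> (\<Prod>i\<in>UNIV. 2 ^ m * \<bar>x $ i\<bar> ^ \<alpha> S i)"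
    proof (intro prod_mono conjI)
      fix i
      show "(1 + (x $ i)\<^sup>2) ^ m \<le> 2 ^ m * \<bar>x $ i\<bar> ^ \<alpha> S i"
      proof (cases "i \<in> S")
        case True
        then have "1 \<le> (x $ i)\<^sup>2"
          using power_mono[of 1 "\<bar>x $ i\<bar>" 2] by (simp add: S_def)
        then have "(1 + (x $ i)\<^sup>2) ^ m \<le> (2 * (x $ i)\<^sup>2) ^ m"
          by (intro power_mono) auto
        then show ?thesis
          using True by (simp add: \<alpha>_def power_mult_distrib power_mult)
      next
        case False
        then have "(1 + (x $ i)\<^sup>2) ^ m \<le> 2 ^ m"
          by (intro power_mono) (auto simp: S_def abs_square_le_1)
        with False show ?thesis by (simp add: \<alpha>_def)
      qed
    qed auto
    also have "\<dots> = (2 ^ m) ^ CARD('n) * \<bar>\<Prod>i\<in>UNIV. (x $ i) ^ \<alpha> S i\<bar>"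
      by (simp only: prod.distrib prod_constant abs_prod power_abs)
    finally have "norm (iter_partial_deriv is g x) * weight x ^ m
        \<le> norm (iter_partial_deriv is g x) * ((2 ^ m) ^ CARD('n) * \<bar>\<Prod>i\<in>UNIV. (x $ i) ^ \<alpha> S i\<bar>)"
      by (rule mult_left_mono) simp
    also have "\<dots> = (2 ^ m) ^ CARD('n)
        * norm (of_real (\<Prod>i\<in>UNIV. (x $ i) ^ \<alpha> S i) * iter_partial_deriv is g x)"
      by (simp only: norm_mult norm_of_real mult_ac)
    also have "\<dots> \<le> (2 ^ m) ^ CARD('n) * B (\<alpha> S)"
      by (intro mult_left_mono B) simp
    also have "B (\<alpha> S) \<le> K"
      unfolding K_def by (rule order_trans[OF abs_ge_self]) (rule member_le_sum, auto)
    finally show ?thesis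
      by simp
  qed
  then show ?thesis by blast
qed

text \<open>The free exponent \<open>m\<close> is spent as needed: 0 for boundedness, 1 for
  integrability, 2 when one factor is to be traded for decay in a shift.\<close>

lemma schwartz_decay:
  fixes g :: "real^'n::finite \<Rightarrow> complex"
  assumes "g \<in> schwartz_class"
  shows "\<exists>C\<ge>0. \<forall>x. norm (iter_partial_deriv is g x) \<le> C * decay x ^ m"
proof -
  obtain C where C: "norm (iter_partial_deriv is g x) * weight x ^ m \<le> C" for x
    using schwartz_weight_bounded[OF assms] by metis
  have "norm (iter_partial_deriv is g x) \<le> C / weight x ^ m" for x
    using C by (simp only: pos_le_divide_eq zero_less_power weight_pos)
  moreover have "0 \<le> C"
    by (rule order_trans[OF _ C[of 0]]) (simp add: less_imp_le)
  ultimately show ?thesis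
    by (auto simp: decay_def divide_inverse power_inverse)
qed

text \<open>Avoids computing iterated derivatives: a set closed under single partial derivatives
  contains all of them, so only bounds without derivatives remain to be checked on its
  members.\<close>

lemma schwartz_classI:
  fixes X :: "(real^'n::finite \<Rightarrow> complex) set"
  assumes "f \<in> X"
    and diff: "\<And>u x. u \<in> X \<Longrightarrow> u differentiable (at x)"
    and deriv: "\<And>u i. u \<in> X \<Longrightarrow> partial_deriv i u \<in> X"
    and bound: "\<And>u m. u \<in> X \<Longrightarrow> \<exists>C. \<forall>x. norm (u x) * weight x ^ m \<le> C"
  shows "f \<in> schwartz_class"
proof -
  have X: "iter_partial_deriv is f \<in> X" for "is"
    by (induction "is") (auto simp: assms(1) deriv)
  have "\<exists>B. \<forall>x. norm (of_real (\<Prod>i\<in>UNIV. (x $ i) ^ \<alpha> i) * iter_partial_deriv is f x) \<le> B"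
    for \<alpha> :: "'n \<Rightarrow> nat" and "is"
  proof -
    define m where "m = (\<Sum>i\<in>UNIV. \<alpha> i)"
    obtain C where C: "norm (iter_partial_deriv is f x) * weight x ^ m \<le> C" for x
      using bound[OF X] by metis
    have "norm (of_real (\<Prod>i\<in>UNIV. (x $ i) ^ \<alpha> i) * iter_partial_deriv is f x) \<le> C" for x
    proof -
      have "\<bar>\<Prod>i\<in>UNIV. (x $ i) ^ \<alpha> i\<bar> = (\<Prod>i\<in>UNIV. \<bar>x $ i\<bar> ^ \<alpha> i)"
        by (simp add: abs_prod power_abs)
      also have "\<dots> \<le> (\<Prod>i\<in>UNIV. (1 + (x $ i)\<^sup>2) ^ m)"
      proof (intro prod_mono conjI)
        fix i
        have "\<bar>x $ i\<bar> \<le> 1 + (x $ i)\<^sup>2"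
        proof -
          have "0 \<le> (\<bar>x $ i\<bar> - 1)\<^sup>2 + \<bar>x $ i\<bar>" by simp
          then show ?thesis by (simp add: power2_diff)
        qed
        then have "\<bar>x $ i\<bar> ^ \<alpha> i \<le> (1 + (x $ i)\<^sup>2) ^ \<alpha> i"
          by (intro power_mono) auto
        also have "\<dots> \<le> (1 + (x $ i)\<^sup>2) ^ m"
          by (intro power_increasing) (auto simp: m_def intro: member_le_sum)
        finally show "\<bar>x $ i\<bar> ^ \<alpha> i \<le> (1 + (x $ i)\<^sup>2) ^ m" .
      qed auto
      also have "\<dots> = weight x ^ m"
        by (simp add: weight_def prod_power_distrib)
      finally have "norm (iter_partial_deriv is f x) * \<bar>\<Prod>i\<in>UNIV. (x $ i) ^ \<alpha> i\<bar>
          \<le> norm (iter_partial_deriv is f x) * weight x ^ m"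
        by (rule mult_left_mono) simp
      also note C[of x]
      finally show ?thesis
        by (simp only: norm_mult norm_of_real mult.commute)
    qed
    then show ?thesis by blast
  qed
  then show ?thesis
    using diff[OF X] by (simp add: schwartz_class_def smooth_def)
qed

text \<open>The time-frequency shifts of \<open>g\<close> and of its derivatives span a space that is closed under
  differentiation, so it consists of Schwartz functions.\<close>
inductive_set shift_span :: "(real^'n::finite \<Rightarrow> complex) \<Rightarrow> (real^'n \<Rightarrow> complex) set"
  for g where
  shift: "(\<lambda>y. c * ch (\<eta> \<bullet> y) * iter_partial_deriv is g (y - x)) \<in> shift_span g"
| add: "u \<in> shift_span g \<Longrightarrow> v \<in> shift_span g \<Longrightarrow> (\<lambda>y. u y + v y) \<in> shift_span g"

lemma shift_has_derivative:
  assumes "g \<in> schwartz_class"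
  shows "((\<lambda>y. c * ch (\<eta> \<bullet> y) * iter_partial_deriv is g (y - x)) has_derivative
    (\<lambda>h. c * ch (\<eta> \<bullet> y) * frechet_derivative (iter_partial_deriv is g) (at (y - x)) h
      + (c * ((\<eta> \<bullet> h) *\<^sub>R (2 * pi * \<i> * ch (\<eta> \<bullet> y)))) * iter_partial_deriv is g (y - x))) (at y)"
proof -
  have "(iter_partial_deriv is g has_derivative
      frechet_derivative (iter_partial_deriv is g) (at (y - x))) (at (y - x))"
    using schwartz_differentiable[OF assms] by (simp add: frechet_derivative_works)
  then have "((\<lambda>y. iter_partial_deriv is g (y - x)) has_derivative
      frechet_derivative (iter_partial_deriv is g) (at (y - x))) (at y)"
    by (rule has_derivative_compose[where f="\<lambda>y. y - x", rotated]) (auto intro!: derivative_eq_intros)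
  then show ?thesis
    by (auto intro!: derivative_eq_intros)
qed

lemma shift_span_differentiable:
  assumes "g \<in> schwartz_class" "u \<in> shift_span g"
  shows "u differentiable (at y)"
  using assms(2) by induction (auto intro: differentiableI[OF shift_has_derivative[OF assms(1)]])

lemma partial_deriv_add:
  assumes "u differentiable (at y)" "v differentiable (at y)"
  shows "partial_deriv i (\<lambda>y. u y + v y) y = partial_deriv i u y + partial_deriv i v y"
  using assms unfolding frechet_derivative_works
  by (subst partial_deriv_eq[OF has_derivative_add]) (auto simp: partial_deriv_def)

lemma shift_span_partial_deriv:
  assumes "g \<in> schwartz_class" "u \<in> shift_span g"
  shows "partial_deriv i u \<in> shift_span g"
  using assms(2)
proof induction
  case (shift c \<eta> "is" x)
  have "partial_deriv i (\<lambda>y. c * ch (\<eta> \<bullet> y) * iter_partial_deriv is g (y - x))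
    = (\<lambda>y. c * ch (\<eta> \<bullet> y) * iter_partial_deriv (i # is) g (y - x)
        + (c * 2 * pi * \<i> * (\<eta> $ i)) * ch (\<eta> \<bullet> y) * iter_partial_deriv is g (y - x))"
    by (rule ext, subst partial_deriv_eq[OF shift_has_derivative[OF assms(1)]])
       (simp add: partial_deriv_def inner_axis scaleR_conv_of_real)
  then show ?case
    by (simp only: shift_span.intros)
next
  case (add u v)
  have "partial_deriv i (\<lambda>y. u y + v y) = (\<lambda>y. partial_deriv i u y + partial_deriv i v y)"
    by (rule ext, rule partial_deriv_add)
       (use add shift_span_differentiable[OF assms(1)] in auto)
  with add show ?case
    by (simp only: shift_span.intros)
qed

lemma shift_span_weight_bounded:
  assumes "g \<in> schwartz_class" "u \<in> shift_span (g :: real^'n::finite \<Rightarrow> complex)"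
  shows "\<exists>C. \<forall>x. norm (u x) * weight x ^ m \<le> C"
  using assms(2)
proof induction
  case (shift c \<eta> "is" x)
  obtain C where C: "norm (iter_partial_deriv is g y) * weight y ^ m \<le> C" for y
    using schwartz_weight_bounded[OF assms(1)] by metis
  have "norm (c * ch (\<eta> \<bullet> y) * iter_partial_deriv is g (y - x)) * weight y ^ m
      \<le> norm c * ((2 ^ CARD('n) * weight x) ^ m * C)" for y
  proof -
    have "weight y \<le> (2 ^ CARD('n) * weight x) * weight (y - x)"
      using weight_add_le[of x "y - x"] by simp
    then have "weight y ^ m \<le> ((2 ^ CARD('n) * weight x) * weight (y - x)) ^ m"
      by (rule power_mono) (simp add: less_imp_le)
    then have "norm (iter_partial_deriv is g (y - x)) * weight y ^ m
        \<le> norm (iter_partial_deriv is g (y - x)) * ((2 ^ CARD('n) * weight x) ^ m * weight (y - x) ^ m)"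
      by (intro mult_left_mono) (auto simp: power_mult_distrib)
    also have "\<dots> = (2 ^ CARD('n) * weight x) ^ m
        * (norm (iter_partial_deriv is g (y - x)) * weight (y - x) ^ m)"
      by (simp only: mult_ac)
    also have "\<dots> \<le> (2 ^ CARD('n) * weight x) ^ m * C"
      by (intro mult_left_mono C) (simp add: less_imp_le)
    finally have "norm c * (norm (iter_partial_deriv is g (y - x)) * weight y ^ m)
        \<le> norm c * ((2 ^ CARD('n) * weight x) ^ m * C)"
      by (rule mult_left_mono) simp
    then show ?thesis
      by (simp only: norm_mult norm_ch mult_1_right mult.assoc)
  qed
  then show ?case by blast
next
  case (add u v)
  then obtain C D where "norm (u x) * weight x ^ m \<le> C" "norm (v x) * weight x ^ m \<le> D" for x
    by metis
  then have "(norm (u x) + norm (v x)) * weight x ^ m \<le> C + D" for x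
    by (simp add: distrib_right add_mono)
  moreover have "norm (u x + v x) * weight x ^ m \<le> (norm (u x) + norm (v x)) * weight x ^ m" for x
    by (intro mult_right_mono norm_triangle_ineq) (simp add: less_imp_le)
  ultimately show ?case
    using order_trans by blast
qed

lemma shift_span_subset_schwartz:
  assumes "g \<in> schwartz_class"
  shows "shift_span g \<subseteq> schwartz_class"
proof
  fix f assume "f \<in> shift_span g"
  then show "f \<in> schwartz_class"
    by (rule schwartz_classI)
       (use shift_span_differentiable shift_span_partial_deriv shift_span_weight_bounded assms in blast)+
qed

lemma sum_shifts_in_schwartz:
  fixes g :: "real^'n::finite \<Rightarrow> complex" and K :: nat
  assumes "g \<in> schwartz_class"
  shows "(\<lambda>y. \<Sum>k<K. ch (\<eta> k \<bullet> y) * g (y - x k)) \<in> schwartz_class"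
proof -
  have "(\<lambda>y. \<Sum>k<K. ch (\<eta> k \<bullet> y) * g (y - x k)) \<in> shift_span g"
  proof (induction K)
    case 0
    show ?case
      using shift_span.shift[of 0 0 "[]" g 0] by simp
  next
    case (Suc K)
    show ?case
      using shift_span.add[OF Suc shift_span.shift[of 1 "\<eta> K" "[]" g "x K"]] by simp
  qed
  then show ?thesis
    using shift_span_subset_schwartz[OF assms] by blast
qed

section \<open>Decay of Fourier and short-time Fourier transforms of Schwartz functions\<close>

lemma stft_eq: "stft g f z \<zeta> = fourier_transform (\<lambda>y. f y * cnj (g (y - z))) \<zeta>"
  unfolding stft_def fourier_transform_eq exp_minus_eq_ch by (simp add: mult_ac inner_commute)

lemma schwartz_measurable:
  "g \<in> schwartz_class \<Longrightarrow> iter_partial_deriv is g \<in> borel_measurable borel"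
  by (intro measurable_if_differentiable schwartz_differentiable)

lemma fourier_transform_decay:
  fixes g :: "real^'n::finite \<Rightarrow> complex"
  assumes g: "g \<in> schwartz_class"
  shows "\<exists>C>0. \<forall>\<xi>. norm (fourier_transform g \<xi>) \<le> C * decay \<xi>"
proof -
  \<comment> \<open>Each factor of the monomial is absorbed by one more derivative of
    \<open>g\<close>, which is why the induction runs over all derivatives \<open>a\<close> at
    once.\<close>
  have monomial: "\<exists>C. \<forall>\<xi>. norm (fourier_transform (iter_partial_deriv a g) \<xi>)
      * (\<Prod>i\<leftarrow>is. \<bar>2 * pi * \<xi> $ i\<bar>) \<le> C" for a "is"
  proof (induction "is" arbitrary: a)
    case Nil
    obtain C where "norm (iter_partial_deriv a g x) \<le> C * decay x" for x
      using schwartz_decay[OF g, of a 1] by auto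
    then have "norm (fourier_transform (iter_partial_deriv a g) \<xi>) \<le> C * (LINT x|lborel. decay (x::real^'n))" for \<xi>
      by (intro norm_fourier_transform_le schwartz_measurable[OF g])
    then show ?case
      by (intro exI[of _ "C * (LINT x|lborel. decay (x::real^'n))"]) simp
  next
    case (Cons i "is")
    obtain C C' where "norm (iter_partial_deriv a g x) \<le> C * decay x"
      "norm (iter_partial_deriv (i # a) g x) \<le> C' * decay x" for x
      using schwartz_decay[OF g, of a 1] schwartz_decay[OF g, of "i # a" 1] by (auto simp del: iter_partial_deriv.simps)
    then have "fourier_transform (iter_partial_deriv (i # a) g) \<xi>
        = 2 * pi * \<i> * (\<xi> $ i) * fourier_transform (iter_partial_deriv a g) \<xi>" for \<xi>
      using fourier_transform_partial_deriv[OF schwartz_differentiable[OF g, of a], of C i C' \<xi>]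
        schwartz_measurable[OF g, of "i # a"] by simp
    then have "norm (fourier_transform (iter_partial_deriv (i # a) g) \<xi>)
        = \<bar>2 * pi * \<xi> $ i\<bar> * norm (fourier_transform (iter_partial_deriv a g) \<xi>)" for \<xi>
      by (simp add: norm_mult abs_mult)
    then have "norm (fourier_transform (iter_partial_deriv (i # a) g) \<xi>) * (\<Prod>i\<leftarrow>is. \<bar>2 * pi * \<xi> $ i\<bar>)
        = norm (fourier_transform (iter_partial_deriv a g) \<xi>) * (\<Prod>i\<leftarrow>i # is. \<bar>2 * pi * \<xi> $ i\<bar>)" for \<xi>
      by simp
    then show ?case
      using Cons.IH[of "i # a"] by (simp only:)
  qed
  \<comment> \<open>No parameter is present here, so the parameter type is \<open>unit\<close> and
    the weight \<open>A\<close> is constantly 1.\<close>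
  have "\<exists>C>0. \<forall>z::unit. \<forall>\<xi>. norm (fourier_transform g \<xi>) \<le> C * 1 * decay \<xi>"
    by (rule decay_if_monomials_bounded) (use monomial[of "[]"] in auto)
  then show ?thesis by simp
qed

text \<open>The products \<open>u a b z\<close> of derivatives of \<open>g\<close> and of its
  shifted conjugate are closed under differentiation by the Leibniz rule, up to sums. Frequency
  decay comes from these derivatives; decay in \<open>z\<close> comes from the two factors being
  concentrated at distance \<open>z\<close> from each other.\<close>

lemma stft_decay:
  fixes g :: "real^'n::finite \<Rightarrow> complex"
  assumes g: "g \<in> schwartz_class"
  shows "\<exists>C>0. \<forall>z \<zeta>. norm (stft g g z \<zeta>) \<le> C * decay z * decay \<zeta>"
proof -
  define u where "u a b z y = iter_partial_deriv a g y * cnj (iter_partial_deriv b g (y - z))" for a b z y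
  have u_deriv: "(u a b z has_derivative (\<lambda>h. iter_partial_deriv a g y
        * cnj (frechet_derivative (iter_partial_deriv b g) (at (y - z)) h)
      + frechet_derivative (iter_partial_deriv a g) (at y) h * cnj (iter_partial_deriv b g (y - z)))) (at y)"
    for a b z y
  proof -
    have D: "(iter_partial_deriv b g has_derivative
        frechet_derivative (iter_partial_deriv b g) (at x)) (at x)" for b x
      using schwartz_differentiable[OF g] by (simp add: frechet_derivative_works)
    have "((\<lambda>y. iter_partial_deriv b g (y - z)) has_derivative
        frechet_derivative (iter_partial_deriv b g) (at (y - z))) (at y)"
      using D by (rule has_derivative_compose[where f="\<lambda>y. y - z", rotated]) (auto intro!: derivative_eq_intros)
    then have "((\<lambda>y. cnj (iter_partial_deriv b g (y - z))) has_derivative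
        (\<lambda>h. cnj (frechet_derivative (iter_partial_deriv b g) (at (y - z)) h))) (at y)"
      by (rule bounded_linear.has_derivative[OF bounded_linear_cnj])
    from has_derivative_mult[OF D this] show ?thesis
      unfolding u_def .
  qed
  have pd: "partial_deriv i (u a b z) y = u (i # a) b z y + u a (i # b) z y" for i a b z y
    by (subst partial_deriv_eq[OF u_deriv]) (simp add: u_def partial_deriv_def)
  have meas: "u a b z \<in> borel_measurable borel" for a b z
    by (rule measurable_if_differentiable) (rule differentiableI[OF u_deriv])
  have u_bound: "\<exists>C\<ge>0. \<forall>z y. norm (u a b z y) \<le> C * decay z * decay y" for a b
  proof -
    \<comment> \<open>Two powers of decay in \<open>y\<close>: one remains for integrability, the
      other is combined with \<open>decay (y - z)\<close> by Peetre's inequality and yields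
      \<open>decay z\<close>.\<close>
    obtain C where C: "0 \<le> C" "norm (iter_partial_deriv a g x) \<le> C * decay x ^ 2" for x
      using schwartz_decay[OF g, of a 2] by auto
    obtain D where D: "0 \<le> D" "norm (iter_partial_deriv b g x) \<le> D * decay x" for x
      using schwartz_decay[OF g, of b 1] by auto
    have "norm (u a b z y) \<le> (C * D * 2 ^ CARD('n)) * decay z * decay y" for z y
    proof -
      have "norm (u a b z y) \<le> (C * decay y ^ 2) * (D * decay (y - z))"
        unfolding u_def norm_mult complex_mod_cnj using C D by (intro mult_mono) auto
      also have "\<dots> = (C * D * decay y) * (decay (- y) * decay (y - z))"
        by (simp add: power2_eq_square)
      also have "\<dots> \<le> (C * D * decay y) * (2 ^ CARD('n) * decay (- y + (y - z)))"
        using C(1) D(1) by (intro mult_left_mono decay_mult_le mult_nonneg_nonneg) auto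
      finally show ?thesis
        by (simp add: mult_ac)
    qed
    then show ?thesis
      using C(1) D(1) by (intro exI[of _ "C * D * 2 ^ CARD('n)"]) auto
  qed
  have monomial: "\<exists>C. \<forall>z \<xi>. norm (fourier_transform (u a b z) \<xi>)
      * (\<Prod>i\<leftarrow>is. \<bar>2 * pi * \<xi> $ i\<bar>) \<le> C * decay z" for a b "is"
  proof (induction "is" arbitrary: a b)
    case Nil
    obtain C where C: "norm (u a b z y) \<le> C * decay z * decay y" for z y
      using u_bound by metis
    have "norm (fourier_transform (u a b z) \<xi>) \<le> C * decay z * (LINT x|lborel. decay (x::real^'n))" for z \<xi>
      using meas C by (rule norm_fourier_transform_le)
    then show ?case
      by (intro exI[of _ "C * (LINT x|lborel. decay (x::real^'n))"]) (simp add: mult_ac)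
  next
    case (Cons i "is")
    obtain C D E where CDE: "norm (u a b z y) \<le> C * decay z * decay y"
      "norm (u (i # a) b z y) \<le> D * decay z * decay y" "norm (u a (i # b) z y) \<le> E * decay z * decay y" for z y
      using u_bound[of a b] u_bound[of "i # a" b] u_bound[of a "i # b"] by metis
    obtain M where M: "norm (fourier_transform (u (i # a) b z) \<xi>) * (\<Prod>i\<leftarrow>is. \<bar>2 * pi * \<xi> $ i\<bar>) \<le> M * decay z"
      for z \<xi> using Cons.IH[of "i # a" b] by metis
    obtain N where N: "norm (fourier_transform (u a (i # b) z) \<xi>) * (\<Prod>i\<leftarrow>is. \<bar>2 * pi * \<xi> $ i\<bar>) \<le> N * decay z"
      for z \<xi> using Cons.IH[of a "i # b"] by metis
    have "norm (fourier_transform (u a b z) \<xi>) * (\<Prod>i\<leftarrow>i # is. \<bar>2 * pi * \<xi> $ i\<bar>) \<le> (M + N) * decay z" for z \<xi>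
    proof -
      let ?P = "\<Prod>i\<leftarrow>is. \<bar>2 * pi * \<xi> $ i\<bar>"
      have P: "0 \<le> ?P" by (rule prod_list_nonneg) auto
      have split: "fourier_transform (partial_deriv i (u a b z)) \<xi>
          = fourier_transform (u (i # a) b z) \<xi> + fourier_transform (u a (i # b) z) \<xi>"
      proof -
        have "integrable lborel (\<lambda>y. u (i # a) b z y * ch (- (y \<bullet> \<xi>)))"
          using CDE(2)[of z] meas[of "i # a" b z]
          by (intro integrable_if_decay[where C="D * decay z"]) (auto simp: norm_mult)
        moreover have "integrable lborel (\<lambda>y. u a (i # b) z y * ch (- (y \<bullet> \<xi>)))"
          using CDE(3)[of z] meas[of a "i # b" z]
          by (intro integrable_if_decay[where C="E * decay z"]) (auto simp: norm_mult)
        ultimately show ?thesis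
          by (simp add: fourier_transform_eq pd distrib_right)
      qed
      have "fourier_transform (partial_deriv i (u a b z)) \<xi>
          = 2 * pi * \<i> * (\<xi> $ i) * fourier_transform (u a b z) \<xi>"
      proof (rule fourier_transform_partial_deriv)
        show "u a b z differentiable (at x)" for x
          using u_deriv by (rule differentiableI)
        show "norm (u a b z x) \<le> (C * decay z) * decay x" for x
          using CDE(1) by simp
        show "norm (partial_deriv i (u a b z) x) \<le> (D * decay z + E * decay z) * decay x" for x
          unfolding pd distrib_right
          by (rule order_trans[OF norm_triangle_ineq]) (intro add_mono CDE)
        show "partial_deriv i (u a b z) \<in> borel_measurable borel"
          using meas unfolding pd [abs_def] by measurable
      qed
      then have "\<bar>2 * pi * \<xi> $ i\<bar> * norm (fourier_transform (u a b z) \<xi>)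
          = norm (fourier_transform (u (i # a) b z) \<xi> + fourier_transform (u a (i # b) z) \<xi>)"
        unfolding split [symmetric] by (simp add: norm_mult abs_mult)
      then have "norm (fourier_transform (u a b z) \<xi>) * (\<Prod>i\<leftarrow>i # is. \<bar>2 * pi * \<xi> $ i\<bar>)
          = norm (fourier_transform (u (i # a) b z) \<xi> + fourier_transform (u a (i # b) z) \<xi>) * ?P"
        by (simp only: list.map prod_list.Cons flip: mult.assoc) (simp only: mult.commute)
      also have "\<dots> \<le> (norm (fourier_transform (u (i # a) b z) \<xi>)
          + norm (fourier_transform (u a (i # b) z) \<xi>)) * ?P"
        using P by (intro mult_right_mono norm_triangle_ineq)
      also have "\<dots> \<le> M * decay z + N * decay z"
        unfolding distrib_right using M N by (intro add_mono)
      finally show ?thesis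
        by (simp only: distrib_right)
    qed
    then show ?case by blast
  qed
  have "\<exists>C>0. \<forall>z \<xi>. norm (fourier_transform (u [] [] z) \<xi>) \<le> C * decay z * decay \<xi>"
    by (rule decay_if_monomials_bounded) (use monomial in auto)
  then show ?thesis
    by (simp add: stft_eq u_def [abs_def])
qed

subsection \<open>The multiplier on the time-frequency plane\<close>

lemma continuous_on_lborel_integral:
  fixes F :: "'a::metric_space \<Rightarrow> 'b::euclidean_space \<Rightarrow> complex"
  assumes cont: "\<And>y. continuous_on UNIV (\<lambda>x. F x y)"
    and meas: "\<And>x. F x \<in> borel_measurable borel"
    and bound: "\<And>x y. norm (F x y) \<le> w y"
    and int: "integrable lborel w"
  shows "continuous_on UNIV (\<lambda>x. LINT y|lborel. F x y)"
proof (subst continuous_on_sequentially, intro ballI allI impI)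
  fix X and x :: 'a assume X: "(\<forall>n. X n \<in> UNIV) \<and> X \<longlonglongrightarrow> x"
  have "(\<lambda>n. LINT y|lborel. F (X n) y) \<longlonglongrightarrow> (LINT y|lborel. F x y)"
  proof (rule integral_dominated_convergence[OF _ _ int])
    show "AE y in lborel. (\<lambda>n. F (X n) y) \<longlonglongrightarrow> F x y"
      using cont X by (auto simp: continuous_on_sequentially o_def)
  qed (use meas bound in auto)
  then show "((\<lambda>x. LINT y|lborel. F x y) \<circ> X) \<longlonglongrightarrow> (LINT y|lborel. F x y)"
    by (simp add: o_def)
qed

lemma measurable_cnj [measurable]: "cnj \<in> borel_measurable borel"
  by (rule borel_measurable_continuous_onI) (intro continuous_intros)

lemma integrable_mult_ch:
  fixes a :: "real^'n::finite \<Rightarrow> complex"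
  assumes "integrable lborel a" "f \<in> borel_measurable borel"
  shows "integrable lborel (\<lambda>y. a y * ch (f y))"
  using assms(1) by (rule Bochner_Integration.integrable_bound) (use assms in \<open>auto simp: norm_mult\<close>)

lemma continuous_on_fourier_transform:
  fixes u :: "real^'n::finite \<Rightarrow> complex"
  assumes "integrable lborel u"
  shows "continuous_on UNIV (fourier_transform u)"
  unfolding fourier_transform_eq [abs_def]
proof (rule continuous_on_lborel_integral)
  show "integrable lborel (\<lambda>y. norm (u y))"
    using assms by simp
qed (use assms in \<open>auto intro!: continuous_intros simp: norm_mult\<close>)

lemma lborel_Fubini_ch:
  fixes a b :: "real^'n::finite \<Rightarrow> complex"
  assumes a: "integrable lborel a" and b: "integrable lborel b"
  shows "(LINT y|lborel. LINT \<xi>|lborel. a y * b \<xi> * ch (c * (y \<bullet> \<xi>)))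
    = (LINT \<xi>|lborel. LINT y|lborel. a y * b \<xi> * ch (c * (y \<bullet> \<xi>)))"
proof -
  have [measurable]: "a \<in> borel_measurable borel" "b \<in> borel_measurable borel"
    using a b by auto
  have "integrable (lborel \<Otimes>\<^sub>M lborel) (\<lambda>(\<xi>, y). a y * b \<xi> * ch (c * (y \<bullet> \<xi>)))"
  proof (rule lborel_pair.Fubini_integrable)
    show "integrable lborel (\<lambda>\<xi>. LINT y|lborel. norm (case (\<xi>, y) of (\<xi>, y) \<Rightarrow> a y * b \<xi> * ch (c * (y \<bullet> \<xi>))))"
      using a b by (simp add: norm_mult)
    show "AE \<xi> in lborel. integrable lborel (\<lambda>y. case (\<xi>, y) of (\<xi>, y) \<Rightarrow> a y * b \<xi> * ch (c * (y \<bullet> \<xi>)))"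
      using a by (auto intro!: integrable_mult_ch)
  qed measurable
  then show ?thesis
    by (rule lborel_pair.Fubini_integral)
qed

lemma fourier_transform_shift:
  fixes g :: "real^'n::finite \<Rightarrow> complex"
  shows "fourier_transform (\<lambda>y. ch (\<eta> \<bullet> y) * g (y - x)) \<xi>
    = ch (- (x \<bullet> (\<xi> - \<eta>))) * fourier_transform g (\<xi> - \<eta>)"
proof -
  have "fourier_transform (\<lambda>y. ch (\<eta> \<bullet> y) * g (y - x)) \<xi>
      = (LINT y|lborel. ch (\<eta> \<bullet> (y + x)) * g (y + x - x) * ch (- ((y + x) \<bullet> \<xi>)))"
    unfolding fourier_transform_eq by (rule lborel_integral_translate[symmetric])
  also have "\<dots> = (LINT y|lborel. ch (- (x \<bullet> (\<xi> - \<eta>))) * (g y * ch (- (y \<bullet> (\<xi> - \<eta>)))))"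
  proof (rule Bochner_Integration.integral_cong)
    fix y
    have "ch (\<eta> \<bullet> (y + x)) * ch (- ((y + x) \<bullet> \<xi>)) = ch (- (x \<bullet> (\<xi> - \<eta>))) * ch (- (y \<bullet> (\<xi> - \<eta>)))"
      unfolding ch_add [symmetric] by (rule arg_cong[of _ _ ch]) (simp add: inner_simps inner_commute algebra_simps)
    then show "ch (\<eta> \<bullet> (y + x)) * g (y + x - x) * ch (- ((y + x) \<bullet> \<xi>))
        = ch (- (x \<bullet> (\<xi> - \<eta>))) * (g y * ch (- (y \<bullet> (\<xi> - \<eta>))))"
      by (simp add: mult_ac)
  qed simp
  finally show ?thesis
    by (simp add: fourier_transform_eq)
qed

lemma norm_stft_shift:
  fixes g :: "real^'n::finite \<Rightarrow> complex"
  shows "norm (stft g (\<lambda>y. ch (\<eta> \<bullet> y) * g (y - x)) z \<zeta>) = norm (stft g g (z - x) (\<zeta> - \<eta>))"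
proof -
  have "(\<lambda>y. ch (\<eta> \<bullet> y) * g (y - x) * cnj (g (y - z)))
      = (\<lambda>y. ch (\<eta> \<bullet> y) * (g (y - x) * cnj (g (y - x - (z - x)))))"
    by (auto simp: mult_ac)
  then show ?thesis
    using fourier_transform_shift[of \<eta> "\<lambda>y. g y * cnj (g (y - (z - x)))" x \<zeta>]
    by (simp add: stft_eq norm_mult)
qed

section \<open>Chirps and the shear of the time-frequency plane\<close>

definition chirp :: "real \<Rightarrow> real^'n::finite \<Rightarrow> complex" where
  "chirp t \<xi> = ch (t * (norm \<xi>)\<^sup>2 / 2)"

lemma chirp_eq: "exp (of_real pi * \<i> * of_real t * of_real ((norm \<xi>)\<^sup>2)) = chirp t \<xi>"
  unfolding chirp_def exp_eq_ch [symmetric] by (rule arg_cong[of _ _ exp]) (simp add: field_simps)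

lemma norm_chirp [simp]: "norm (chirp t \<xi>) = 1"
  by (simp add: chirp_def)

lemma continuous_on_chirp [continuous_intros]:
  "continuous_on S f \<Longrightarrow> continuous_on S (\<lambda>x. chirp t (f x))"
  unfolding chirp_def by (intro continuous_intros) auto

lemma measurable_chirp [measurable]: "chirp t \<in> borel_measurable borel"
  by (rule borel_measurable_continuous_onI) (intro continuous_intros)

text \<open>The cross term is a character in \<open>\<xi>\<close>, and multiplication by a character
  in frequency is a translation in time. This is the whole origin of the shear.\<close>

lemma chirp_add: "chirp t (\<xi> + \<eta>) = chirp t \<xi> * chirp t \<eta> * ch (t * (\<xi> \<bullet> \<eta>))"
  unfolding chirp_def ch_add [symmetric] power2_norm_eq_inner
  by (rule arg_cong[of _ _ ch]) (simp add: inner_simps inner_commute field_simps)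

text \<open>Up to a unimodular factor this is the short-time Fourier transform of the multiplier applied
  to \<open>g\<close>, transferred to the frequency side by Fubini's theorem.\<close>
definition amb :: "real \<Rightarrow> (real^'n::finite \<Rightarrow> complex) \<Rightarrow> real^'n \<Rightarrow> real^'n \<Rightarrow> complex" where
  "amb t g z \<zeta> = (LINT s|lborel. chirp t s * fourier_transform g s
     * cnj (fourier_transform g (s - \<zeta>)) * ch (z \<bullet> s))"

text \<open>A Parseval identity: exchanging the integrals moves the Fourier transform onto the
  shifted window. Since \<open>h\<close> is an arbitrary integrable function, no Fourier inversion
  is involved.\<close>

lemma stft_inverse_fourier:
  fixes g h :: "real^'n::finite \<Rightarrow> complex"
  assumes g: "integrable lborel g" and h: "integrable lborel h"
  shows "stft g (\<lambda>x. LINT \<xi>|lborel. ch (x \<bullet> \<xi>) * h \<xi>) z \<zeta>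
    = (LINT \<xi>|lborel. h \<xi> * cnj (fourier_transform g (\<xi> - \<zeta>)) * ch (z \<bullet> (\<xi> - \<zeta>)))"
proof -
  define a where "a y = cnj (g (y - z)) * ch (- (y \<bullet> \<zeta>))" for y
  have a: "integrable lborel a"
    unfolding a_def using lborel_integrable_translate[OF g, of "- z"]
    by (intro integrable_mult_ch) auto
  have "stft g (\<lambda>x. LINT \<xi>|lborel. ch (x \<bullet> \<xi>) * h \<xi>) z \<zeta>
      = (LINT y|lborel. a y * (LINT \<xi>|lborel. ch (y \<bullet> \<xi>) * h \<xi>))"
    unfolding stft_eq fourier_transform_eq a_def by (simp only: mult_ac)
  also have "\<dots> = (LINT y|lborel. LINT \<xi>|lborel. a y * h \<xi> * ch (1 * (y \<bullet> \<xi>)))"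
    by (simp add: mult_ac flip: integral_mult_right_zero)
  also have "\<dots> = (LINT \<xi>|lborel. LINT y|lborel. a y * h \<xi> * ch (1 * (y \<bullet> \<xi>)))"
    using a h by (rule lborel_Fubini_ch)
  also have "\<dots> = (LINT \<xi>|lborel. h \<xi> * cnj (fourier_transform g (\<xi> - \<zeta>)) * ch (z \<bullet> (\<xi> - \<zeta>)))"
  proof (rule Bochner_Integration.integral_cong)
    fix \<xi>
    have eq: "ch (- (y \<bullet> \<zeta>)) * ch (y \<bullet> \<xi>) = cnj (ch (- (y \<bullet> (\<xi> - \<zeta>))))" for y
      unfolding cnj_ch ch_add [symmetric] by (rule arg_cong[of _ _ ch]) (simp add: inner_simps)
    have "(LINT y|lborel. a y * h \<xi> * ch (1 * (y \<bullet> \<xi>)))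
        = (LINT y|lborel. h \<xi> * (cnj (g (y - z)) * (ch (- (y \<bullet> \<zeta>)) * ch (y \<bullet> \<xi>))))"
      unfolding a_def by (simp only: mult_1 mult_ac)
    \<comment> \<open>The trivial character \<open>ch (0 \<bullet> y)\<close> gives the integrand
      the form of a time-frequency shift, with zero modulation.\<close>
    also have "\<dots> = (LINT y|lborel. h \<xi> * cnj (ch (0 \<bullet> y) * g (y - z) * ch (- (y \<bullet> (\<xi> - \<zeta>)))))"
      unfolding eq by simp
    also have "\<dots> = h \<xi> * cnj (LINT y|lborel. ch (0 \<bullet> y) * g (y - z) * ch (- (y \<bullet> (\<xi> - \<zeta>))))"
      by (simp only: integral_mult_right_zero Bochner_Integration.integral_cnj)
    also have "\<dots> = h \<xi> * cnj (fourier_transform (\<lambda>y. ch (0 \<bullet> y) * g (y - z)) (\<xi> - \<zeta>))"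
      by (simp only: fourier_transform_eq)
    also have "\<dots> = h \<xi> * cnj (fourier_transform g (\<xi> - \<zeta>)) * ch (z \<bullet> (\<xi> - \<zeta>))"
      by (simp only: fourier_transform_shift) (simp add: cnj_ch)
    finally show "(LINT y|lborel. a y * h \<xi> * ch (1 * (y \<bullet> \<xi>)))
        = h \<xi> * cnj (fourier_transform g (\<xi> - \<zeta>)) * ch (z \<bullet> (\<xi> - \<zeta>))" .
  qed simp
  finally show ?thesis .
qed

text \<open>The multiplier shears the time-frequency plane: a shift by \<open>(x, \<eta>)\<close> becomes a shift by
  \<open>(x - t \<eta>, \<eta>)\<close>.\<close>
lemma stft_multiplier_shift:
  fixes g :: "real^'n::finite \<Rightarrow> complex"
  shows "(LINT \<xi>|lborel. chirp t \<xi> * fourier_transform (\<lambda>y. ch (\<eta> \<bullet> y) * g (y - x)) \<xi>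
      * cnj (fourier_transform g (\<xi> - \<zeta>)) * ch (z \<bullet> (\<xi> - \<zeta>)))
    = chirp t \<eta> * ch (- (z \<bullet> (\<zeta> - \<eta>))) * amb t g (z + t *\<^sub>R \<eta> - x) (\<zeta> - \<eta>)" (is "?L = _")
proof -
  have "?L = (LINT s|lborel. chirp t (s + \<eta>) * fourier_transform (\<lambda>y. ch (\<eta> \<bullet> y) * g (y - x)) (s + \<eta>)
      * cnj (fourier_transform g (s + \<eta> - \<zeta>)) * ch (z \<bullet> (s + \<eta> - \<zeta>)))"
    by (rule lborel_integral_translate[symmetric])
  also have "\<dots> = (LINT s|lborel. (chirp t \<eta> * ch (- (z \<bullet> (\<zeta> - \<eta>)))) * (chirp t s * fourier_transform g s
      * cnj (fourier_transform g (s - (\<zeta> - \<eta>))) * ch ((z + t *\<^sub>R \<eta> - x) \<bullet> s)))"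
  proof (rule Bochner_Integration.integral_cong)
    fix s
    have "ch (t * (s \<bullet> \<eta>)) * ch (- (x \<bullet> s)) * ch (z \<bullet> (s + \<eta> - \<zeta>))
        = ch (- (z \<bullet> (\<zeta> - \<eta>))) * ch ((z + t *\<^sub>R \<eta> - x) \<bullet> s)"
      unfolding ch_add [symmetric]
      by (rule arg_cong[of _ _ ch]) (simp add: inner_simps inner_commute algebra_simps)
    then have "chirp t \<eta> * (ch (t * (s \<bullet> \<eta>)) * ch (- (x \<bullet> s)) * ch (z \<bullet> (s + \<eta> - \<zeta>)))
        * (chirp t s * fourier_transform g s * cnj (fourier_transform g (s - (\<zeta> - \<eta>))))
      = chirp t \<eta> * (ch (- (z \<bullet> (\<zeta> - \<eta>))) * ch ((z + t *\<^sub>R \<eta> - x) \<bullet> s))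
        * (chirp t s * fourier_transform g s * cnj (fourier_transform g (s - (\<zeta> - \<eta>))))"
      by (simp only:)
    moreover have "cnj (fourier_transform g (s + \<eta> - \<zeta>)) = cnj (fourier_transform g (s - (\<zeta> - \<eta>)))"
      by (simp add: algebra_simps)
    ultimately show "chirp t (s + \<eta>) * fourier_transform (\<lambda>y. ch (\<eta> \<bullet> y) * g (y - x)) (s + \<eta>)
        * cnj (fourier_transform g (s + \<eta> - \<zeta>)) * ch (z \<bullet> (s + \<eta> - \<zeta>))
      = (chirp t \<eta> * ch (- (z \<bullet> (\<zeta> - \<eta>)))) * (chirp t s * fourier_transform g s
        * cnj (fourier_transform g (s - (\<zeta> - \<eta>))) * ch ((z + t *\<^sub>R \<eta> - x) \<bullet> s))"
      unfolding fourier_transform_shift chirp_add by (simp only: add_diff_cancel_right' mult_ac)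
  qed simp
  finally show ?thesis
    by (simp only: integral_mult_right_zero amb_def)
qed

lemma schwartz_integrable:
  assumes "g \<in> schwartz_class"
  shows "integrable lborel g"
proof -
  obtain C where "norm (g x) \<le> C * decay x" for x
    using schwartz_decay[OF assms, of "[]" 1] by auto
  then show ?thesis
    using schwartz_measurable[OF assms, of "[]"] by (intro integrable_if_decay) auto
qed

lemma integrable_shift:
  fixes g :: "real^'n::finite \<Rightarrow> complex"
  assumes "integrable lborel g"
  shows "integrable lborel (\<lambda>y. ch (\<eta> \<bullet> y) * g (y - x))"
  using integrable_mult_ch[OF lborel_integrable_translate[OF assms, of "- x"], of "\<lambda>y. \<eta> \<bullet> y"]
  by (simp add: mult.commute)

lemma fourier_transform_sum:
  fixes u :: "'a \<Rightarrow> real^'n::finite \<Rightarrow> complex"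
  assumes "\<And>k. k \<in> K \<Longrightarrow> integrable lborel (u k)"
  shows "fourier_transform (\<lambda>y. \<Sum>k\<in>K. u k y) \<xi> = (\<Sum>k\<in>K. fourier_transform (u k) \<xi>)"
  unfolding fourier_transform_eq sum_distrib_right
  by (rule Bochner_Integration.integral_sum) (use assms in \<open>auto intro: integrable_mult_ch\<close>)

lemma norm_stft_sum_shifts_le:
  fixes g :: "real^'n::finite \<Rightarrow> complex"
  assumes g: "g \<in> schwartz_class"
  shows "norm (stft g (\<lambda>y. \<Sum>k\<in>K. ch (\<eta> k \<bullet> y) * g (y - x k)) z \<zeta>)
    \<le> (\<Sum>k\<in>K. norm (stft g g (z - x k) (\<zeta> - \<eta> k)))"
proof -
  obtain C where C: "0 \<le> C" "norm (g x) \<le> C" for x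
    using schwartz_decay[OF g, of "[]" 0] by auto
  have C': "norm (a * cnj (g y)) \<le> norm (C * norm a)" for a y
    using mult_right_mono[OF C(2)[of y] norm_ge_zero[of a]] C(1) by (simp add: norm_mult mult.commute)
  have "integrable lborel (\<lambda>y. ch (\<eta> k \<bullet> y) * g (y - x k) * cnj (g (y - z)))" for k
  proof (rule Bochner_Integration.integrable_bound)
    show "integrable lborel (\<lambda>y. C * norm (ch (\<eta> k \<bullet> y) * g (y - x k)))"
      using integrable_shift[OF schwartz_integrable[OF g]] by (intro integrable_mult_right integrable_norm)
    show "AE y in lborel. norm (ch (\<eta> k \<bullet> y) * g (y - x k) * cnj (g (y - z)))
        \<le> norm (C * norm (ch (\<eta> k \<bullet> y) * g (y - x k)))"
      by (intro always_eventually allI C')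
    show "(\<lambda>y. ch (\<eta> k \<bullet> y) * g (y - x k) * cnj (g (y - z))) \<in> borel_measurable lborel"
      using schwartz_measurable[OF g, of "[]"] by simp measurable
  qed
  then have "stft g (\<lambda>y. \<Sum>k\<in>K. ch (\<eta> k \<bullet> y) * g (y - x k)) z \<zeta>
      = (\<Sum>k\<in>K. stft g (\<lambda>y. ch (\<eta> k \<bullet> y) * g (y - x k)) z \<zeta>)"
    unfolding stft_eq sum_distrib_right by (rule fourier_transform_sum)
  then show ?thesis
    unfolding norm_stft_shift [symmetric] by (simp add: norm_sum)
qed

lemma fourier_transform_integrable:
  fixes g :: "real^'n::finite \<Rightarrow> complex"
  assumes g: "g \<in> schwartz_class"
  shows "integrable lborel (fourier_transform g)"
proof -
  obtain C where "norm (fourier_transform g \<xi>) \<le> C * decay \<xi>" for \<xi>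
    using fourier_transform_decay[OF g] by auto
  then show ?thesis
    using borel_measurable_continuous_onI[OF continuous_on_fourier_transform[OF schwartz_integrable[OF g]]]
    by (intro integrable_if_decay)
qed

lemma fourier_multiplier_eq:
  "fourier_multiplier (\<lambda>\<xi>. exp (of_real pi * \<i> * of_real t * of_real ((norm \<xi>)\<^sup>2))) f
    = (\<lambda>x. LINT \<xi>|lborel. ch (x \<bullet> \<xi>) * (chirp t \<xi> * fourier_transform f \<xi>))"
  unfolding fourier_multiplier_def chirp_eq exp_eq_ch by (simp only: mult.assoc)

lemma amb_integrable:
  fixes g :: "real^'n::finite \<Rightarrow> complex"
  assumes g: "g \<in> schwartz_class"
  shows "integrable lborel (\<lambda>s. chirp t s * fourier_transform g s * cnj (fourier_transform g (s - \<zeta>)))"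
proof -
  obtain C where C: "norm (fourier_transform g \<xi>) \<le> C * decay \<xi>" "0 < C" for \<xi>
    using fourier_transform_decay[OF g] by auto
  have C1: "norm (fourier_transform g \<xi>) \<le> C" for \<xi>
    by (rule order_trans[OF C(1) mult_left_le[OF decay_le_1]]) (use C(2) in simp)
  have [measurable]: "fourier_transform g \<in> borel_measurable borel"
    using fourier_transform_integrable[OF g] by auto
  show ?thesis
  proof (rule integrable_if_decay[where C="C * C"])
    show "norm (chirp t s * fourier_transform g s * cnj (fourier_transform g (s - \<zeta>))) \<le> C * C * decay s" for s
      using mult_mono[OF C(1) C1, of s "s - \<zeta>"] C(2) by (simp add: norm_mult mult_ac less_imp_le)
  qed measurable
qed

lemma stft_multiplier_sum_shifts:
  fixes g :: "real^'n::finite \<Rightarrow> complex" and f :: "real^'n \<Rightarrow> complex" and K :: "'a set"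
    and \<eta> x :: "'a \<Rightarrow> real^'n"
  defines "f \<equiv> \<lambda>y. \<Sum>k\<in>K. ch (\<eta> k \<bullet> y) * g (y - x k)"
  assumes g: "g \<in> schwartz_class"
  shows "stft g (\<lambda>x. LINT \<xi>|lborel. ch (x \<bullet> \<xi>) * (chirp t \<xi> * fourier_transform f \<xi>)) z \<zeta>
    = (\<Sum>k\<in>K. chirp t (\<eta> k) * ch (- (z \<bullet> (\<zeta> - \<eta> k))) * amb t g (z + t *\<^sub>R \<eta> k - x k) (\<zeta> - \<eta> k))"
proof -
  let ?G = "fourier_transform g"
  let ?F = "\<lambda>k. fourier_transform (\<lambda>y. ch (\<eta> k \<bullet> y) * g (y - x k))"
  have [measurable]: "?G \<in> borel_measurable borel"
    using fourier_transform_integrable[OF g] by auto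
  obtain C where C: "norm (?G \<xi>) \<le> C * decay \<xi>" "0 < C" for \<xi>
    using fourier_transform_decay[OF g] by auto
  have C1: "norm (?G \<xi>) \<le> C" for \<xi>
    by (rule order_trans[OF C(1) mult_left_le[OF decay_le_1]]) (use C(2) in simp)
  have F: "fourier_transform f \<xi> = (\<Sum>k\<in>K. ?F k \<xi>)" for \<xi>
    unfolding f_def by (rule fourier_transform_sum) (rule integrable_shift[OF schwartz_integrable[OF g]])
  have iF: "integrable lborel (?F k)" for k
  proof -
    have "integrable lborel (\<lambda>\<xi>. ?G (\<xi> - \<eta> k) * ch (- (x k \<bullet> (\<xi> - \<eta> k))))"
      using lborel_integrable_translate[OF fourier_transform_integrable[OF g], of "- \<eta> k"]
      by (intro integrable_mult_ch) auto
    then show ?thesis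
      by (simp add: fourier_transform_shift [abs_def] mult.commute)
  qed
  have mF [measurable]: "?F k \<in> borel_measurable borel" for k
    using iF by auto
  have "integrable lborel (fourier_transform f)"
    unfolding F [abs_def] using iF by auto
  then have "integrable lborel (\<lambda>\<xi>. chirp t \<xi> * fourier_transform f \<xi>)"
    by (rule Bochner_Integration.integrable_bound)
       (use \<open>integrable lborel (fourier_transform f)\<close> in \<open>auto simp: norm_mult\<close>)
  then have "stft g (\<lambda>x. LINT \<xi>|lborel. ch (x \<bullet> \<xi>) * (chirp t \<xi> * fourier_transform f \<xi>)) z \<zeta>
      = (LINT \<xi>|lborel. chirp t \<xi> * fourier_transform f \<xi> * cnj (?G (\<xi> - \<zeta>)) * ch (z \<bullet> (\<xi> - \<zeta>)))"
    by (rule stft_inverse_fourier[OF schwartz_integrable[OF g]])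
  also have "\<dots> = (LINT \<xi>|lborel. (\<Sum>k\<in>K. chirp t \<xi> * ?F k \<xi> * cnj (?G (\<xi> - \<zeta>)) * ch (z \<bullet> (\<xi> - \<zeta>))))"
    by (simp only: F sum_distrib_left sum_distrib_right)
  also have "\<dots> = (\<Sum>k\<in>K. LINT \<xi>|lborel. chirp t \<xi> * ?F k \<xi> * cnj (?G (\<xi> - \<zeta>)) * ch (z \<bullet> (\<xi> - \<zeta>)))"
  proof (rule Bochner_Integration.integral_sum)
    fix k
    have "integrable lborel (\<lambda>\<xi>. C * norm (?F k \<xi>))"
      using iF by auto
    then show "integrable lborel (\<lambda>\<xi>. chirp t \<xi> * ?F k \<xi> * cnj (?G (\<xi> - \<zeta>)) * ch (z \<bullet> (\<xi> - \<zeta>)))"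
    proof (rule Bochner_Integration.integrable_bound)
      show "AE \<xi> in lborel. norm (chirp t \<xi> * ?F k \<xi> * cnj (?G (\<xi> - \<zeta>)) * ch (z \<bullet> (\<xi> - \<zeta>)))
          \<le> norm (C * norm (?F k \<xi>))"
      proof (intro always_eventually allI)
        fix \<xi>
        have "norm (?F k \<xi>) * norm (?G (\<xi> - \<zeta>)) \<le> norm (?F k \<xi>) * C"
          by (intro mult_left_mono C1) simp
        then show "norm (chirp t \<xi> * ?F k \<xi> * cnj (?G (\<xi> - \<zeta>)) * ch (z \<bullet> (\<xi> - \<zeta>)))
            \<le> norm (C * norm (?F k \<xi>))"
          using C(2) by (simp add: norm_mult mult.commute)
      qed
    qed measurable
  qed
  finally show ?thesis
    by (simp only: stft_multiplier_shift)
qed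

text \<open>The i-th coordinate of \<open>s\<close> or of \<open>s - \<zeta>\<close> has modulus at
  least half that of \<open>\<zeta> $ i\<close>. Hence one of the two factors in the integrand
  supplies the decay in \<open>\<zeta> $ i\<close>, and the other remains integrable in
  \<open>s\<close>. Decay in one coordinate suffices because the frequencies are spaced along a
  single axis.\<close>

lemma norm_amb_le:
  fixes g :: "real^'n::finite \<Rightarrow> complex"
  assumes g: "g \<in> schwartz_class"
  shows "\<exists>D\<ge>0. \<forall>z \<zeta> i. norm (amb t g z \<zeta>) \<le> D / (1 + (\<zeta> $ i / 2)\<^sup>2)"
proof -
  let ?G = "fourier_transform g"
  let ?I = "LINT x|lborel. decay (x::real^'n)"
  obtain C where C: "norm (?G \<xi>) \<le> C * decay \<xi>" "0 < C" for \<xi>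
    using fourier_transform_decay[OF g] by auto
  have "norm (amb t g z \<zeta>) \<le> C * C * 2 * ?I / (1 + (\<zeta> $ i / 2)\<^sup>2)" for z \<zeta> i
  proof -
    let ?q = "1 / (1 + (\<zeta> $ i / 2)\<^sup>2)"
    have decay: "decay s * decay (s - \<zeta>) \<le> (decay s + decay (s - \<zeta>)) * ?q" for s
    proof -
      have small: "decay v \<le> ?q" if "\<bar>\<zeta> $ i / 2\<bar> \<le> \<bar>v $ i\<bar>" for v :: "real^'n"
      proof -
        have "(\<zeta> $ i / 2)\<^sup>2 \<le> (v $ i)\<^sup>2"
          using that by (simp only: abs_le_square_iff)
        then have "1 / (1 + (v $ i)\<^sup>2) \<le> ?q"
          by (intro divide_left_mono mult_pos_pos add_pos_nonneg add_left_mono) auto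
        then show ?thesis
          using decay_le_component[of v i] by linarith
      qed
      have "\<bar>\<zeta> $ i / 2\<bar> \<le> \<bar>s $ i\<bar> \<or> \<bar>\<zeta> $ i / 2\<bar> \<le> \<bar>(s - \<zeta>) $ i\<bar>"
        by (auto simp: abs_if field_simps)
      then have "decay s \<le> ?q \<or> decay (s - \<zeta>) \<le> ?q"
        using small by blast
      moreover have "0 \<le> ?q"
        by (simp add: add_nonneg_nonneg)
      ultimately show ?thesis
        using mult_right_mono[of "decay s" ?q "decay (s - \<zeta>)"]
          mult_left_mono[of "decay (s - \<zeta>)" ?q "decay s"]
          mult_nonneg_nonneg[of ?q "decay s"] mult_nonneg_nonneg[of ?q "decay (s - \<zeta>)"]
        by (auto simp only: decay_nonneg distrib_right mult.commute[of ?q])  (smt (verit) mult.commute)+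
    qed
    have id: "integrable lborel (\<lambda>s. C * C * ((decay s + decay (s - \<zeta>)) * ?q))"
      using lborel_integrable_translate[OF integrable_decay, of "- \<zeta>"]
      by (intro integrable_mult_right integrable_mult_left Bochner_Integration.integrable_add integrable_decay) auto
    have "norm (amb t g z \<zeta>) \<le> (LINT s|lborel. norm (chirp t s * ?G s * cnj (?G (s - \<zeta>)) * ch (z \<bullet> s)))"
      unfolding amb_def by (rule integral_norm_bound)
    also have "\<dots> \<le> (LINT s|lborel. C * C * ((decay s + decay (s - \<zeta>)) * ?q))"
    proof (rule integral_mono[OF _ id])
      show "integrable lborel (\<lambda>s. norm (chirp t s * ?G s * cnj (?G (s - \<zeta>)) * ch (z \<bullet> s)))"
        by (intro integrable_norm integrable_mult_ch amb_integrable[OF g]) simp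
      fix s
      have "norm (chirp t s * ?G s * cnj (?G (s - \<zeta>)) * ch (z \<bullet> s)) = norm (?G s) * norm (?G (s - \<zeta>))"
        by (simp add: norm_mult)
      also have "\<dots> \<le> (C * decay s) * (C * decay (s - \<zeta>))"
        using C by (intro mult_mono) (auto simp: less_imp_le)
      also have "\<dots> = C * C * (decay s * decay (s - \<zeta>))"
        by (simp only: mult_ac)
      also have "\<dots> \<le> C * C * ((decay s + decay (s - \<zeta>)) * ?q)"
        using C(2) by (intro mult_left_mono decay) auto
      finally show "norm (chirp t s * ?G s * cnj (?G (s - \<zeta>)) * ch (z \<bullet> s))
          \<le> C * C * ((decay s + decay (s - \<zeta>)) * ?q)" .
    qed
    also have "\<dots> = C * C * 2 * ?I / (1 + (\<zeta> $ i / 2)\<^sup>2)"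
    proof -
      have "(LINT s|lborel. decay s + decay (s - \<zeta>)) = 2 * ?I"
        using lborel_integral_translate[of decay "- \<zeta>"]
          lborel_integrable_translate[OF integrable_decay, of "- \<zeta>"]
        by (subst Bochner_Integration.integral_add) (auto intro: integrable_decay)
      then show ?thesis by simp
    qed
    finally show ?thesis .
  qed
  moreover have "0 \<le> C * C * 2 * ?I"
    using C(2) by (intro mult_nonneg_nonneg integral_nonneg) auto
  ultimately show ?thesis by blast
qed

lemma continuous_on_amb:
  fixes g :: "real^'n::finite \<Rightarrow> complex"
  assumes g: "g \<in> schwartz_class"
  shows "continuous_on UNIV (\<lambda>p. amb t g (fst p) (snd p))"
proof -
  let ?G = "fourier_transform g"
  obtain C where C: "norm (?G \<xi>) \<le> C * decay \<xi>" "0 < C" for \<xi>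
    using fourier_transform_decay[OF g] by auto
  have C1: "norm (?G \<xi>) \<le> C" for \<xi>
    by (rule order_trans[OF C(1) mult_left_le[OF decay_le_1]]) (use C(2) in simp)
  have contG: "continuous_on UNIV ?G"
    by (rule continuous_on_fourier_transform[OF schwartz_integrable[OF g]])
  have [measurable]: "?G \<in> borel_measurable borel"
    using fourier_transform_integrable[OF g] by auto
  show ?thesis
    unfolding amb_def
  proof (rule continuous_on_lborel_integral[where w="\<lambda>s. C * C * decay s"])
    show "continuous_on UNIV (\<lambda>p. chirp t s * ?G s * cnj (?G (s - snd p)) * ch (fst p \<bullet> s))" for s
      by (intro continuous_intros continuous_on_compose2[OF contG]) auto
    show "norm (chirp t s * ?G s * cnj (?G (s - snd p)) * ch (fst p \<bullet> s)) \<le> C * C * decay s" for p s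
      using mult_mono[OF C(1) C1[of "s - snd p"], of s] C(2) by (simp add: norm_mult mult_ac less_imp_le)
    show "integrable lborel (\<lambda>s::real^'n. C * C * decay s)"
      by (intro integrable_mult_right integrable_decay)
  qed measurable
qed

subsection \<open>Injectivity of the Fourier transform\<close>

lemma lborel_integral_prod:
  fixes f :: "'a::euclidean_space \<Rightarrow> real \<Rightarrow> complex"
  assumes f: "\<And>b. b \<in> Basis \<Longrightarrow> integrable lborel (f b)"
  shows "integrable lborel (\<lambda>x::'a. \<Prod>b\<in>Basis. f b (x \<bullet> b))"
    and "(LINT x|(lborel :: 'a measure). (\<Prod>b\<in>Basis. f b (x \<bullet> b))) = (\<Prod>b\<in>Basis. (LINT x|lborel. f b x))"
proof -
  interpret product_sigma_finite "\<lambda>_::'a. lborel :: real measure" ..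
  have T [measurable]: "(\<lambda>v. \<Sum>b\<in>(Basis::'a set). v b *\<^sub>R b) \<in> (\<Pi>\<^sub>M b\<in>Basis. lborel) \<rightarrow>\<^sub>M borel"
    by measurable
  have [measurable]: "f b \<in> borel_measurable borel" if "b \<in> Basis" for b
    using f[OF that] by auto
  have F [measurable]: "(\<lambda>x::'a. \<Prod>b\<in>Basis. f b (x \<bullet> b)) \<in> borel_measurable borel"
    by measurable
  have eq: "(\<Prod>b\<in>Basis. f b ((\<Sum>b\<in>Basis. v b *\<^sub>R b) \<bullet> b)) = (\<Prod>b\<in>Basis. f b (v b))" for v :: "'a \<Rightarrow> real"
    by (intro prod.cong) auto
  have "integrable (\<Pi>\<^sub>M b\<in>Basis. lborel) (\<lambda>v. \<Prod>b\<in>Basis. f b (v b))"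
    by (rule product_integrable_prod) (use f in auto)
  then show "integrable lborel (\<lambda>x::'a. \<Prod>b\<in>Basis. f b (x \<bullet> b))"
    by (subst lborel_eq, subst integrable_distr_eq[OF T F]) (simp only: eq)
  show "(LINT x|(lborel :: 'a measure). (\<Prod>b\<in>Basis. f b (x \<bullet> b))) = (\<Prod>b\<in>Basis. (LINT x|lborel. f b x))"
    by (subst lborel_eq, subst integral_distr[OF T F], simp only: eq)
       (rule product_integral_prod, use f in auto)
qed

lemma std_normal_ch:
  "integrable lborel (\<lambda>x. of_real (std_normal_density x) * ch (a * x))"
  "(LINT x|lborel. of_real (std_normal_density x) * ch (a * x)) = of_real (exp (- (2 * pi * a)\<^sup>2 / 2))"
proof -
  have [measurable]: "std_normal_density \<in> borel_measurable borel"
    by simp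
  have "integrable lborel (\<lambda>x. of_real (std_normal_density x) :: complex)"
    by (intro integrable_of_real) simp
  then show "integrable lborel (\<lambda>x. of_real (std_normal_density x) * ch (a * x))"
    by (rule Bochner_Integration.integrable_bound) (auto simp: norm_mult)
  have "char std_normal_distribution (2 * pi * a)
      = (LINT x|lborel. std_normal_density x *\<^sub>R iexp (2 * pi * a * x))"
    unfolding char_def by (subst integral_density) (auto simp: normal_density_nonneg)
  also have "\<dots> = (LINT x|lborel. of_real (std_normal_density x) * ch (a * x))"
    by (simp add: scaleR_conv_of_real ch_def cis_conv_exp mult_ac)
  finally show "(LINT x|lborel. of_real (std_normal_density x) * ch (a * x)) = of_real (exp (- (2 * pi * a)\<^sup>2 / 2))"
    by (simp add: char_std_normal_distribution)
qed

lemma ch_sum: "ch (\<Sum>i\<in>I. f i) = (\<Prod>i\<in>I. ch (f i))"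
  by (induction I rule: infinite_finite_induct) (auto simp: ch_add)

definition gauss :: "'a::euclidean_space \<Rightarrow> real" where
  "gauss x = (\<Prod>b\<in>Basis. std_normal_density (x \<bullet> b))"

lemma gauss_ch:
  fixes \<xi> :: "'a::euclidean_space"
  shows "integrable lborel (\<lambda>x::'a. of_real (gauss x) * ch (\<xi> \<bullet> x))"
    and "(LINT x|lborel. of_real (gauss x) * ch (\<xi> \<bullet> x)) = of_real (exp (- (2 * pi\<^sup>2 * (norm \<xi>)\<^sup>2)))"
proof -
  let ?f = "\<lambda>(b::'a) (x::real). of_real (std_normal_density x) * ch ((\<xi> \<bullet> b) * x)"
  have eq: "(\<lambda>x::'a. of_real (gauss x) * ch (\<xi> \<bullet> x)) = (\<lambda>x. \<Prod>b\<in>Basis. ?f b (x \<bullet> b))"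
    by (rule ext, subst euclidean_inner) (simp add: gauss_def ch_sum prod.distrib)
  show "integrable lborel (\<lambda>x::'a. of_real (gauss x) * ch (\<xi> \<bullet> x))"
    unfolding eq by (rule lborel_integral_prod) (rule std_normal_ch)
  have "(LINT x|lborel. of_real (gauss x) * ch (\<xi> \<bullet> x)) = (\<Prod>b\<in>Basis. (LINT x|lborel. ?f b x))"
    unfolding eq by (rule lborel_integral_prod) (rule std_normal_ch)
  also have "\<dots> = (\<Prod>b\<in>Basis. of_real (exp (- (2 * pi * (\<xi> \<bullet> b))\<^sup>2 / 2)))"
    by (simp only: std_normal_ch)
  also have "\<dots> = of_real (exp (\<Sum>b\<in>Basis. - (2 * pi * (\<xi> \<bullet> b))\<^sup>2 / 2))"
    by (simp only: exp_sum finite_Basis of_real_prod)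
  also have "(\<Sum>b\<in>Basis. - (2 * pi * (\<xi> \<bullet> b))\<^sup>2 / 2) = - (2 * pi\<^sup>2 * (norm \<xi>)\<^sup>2)"
  proof -
    have "(norm \<xi>)\<^sup>2 = (\<Sum>b\<in>Basis. (\<xi> \<bullet> b)\<^sup>2)"
      unfolding power2_norm_eq_inner by (subst euclidean_inner) (simp add: power2_eq_square)
    then show ?thesis
      by (simp add: sum_distrib_left power_mult_distrib sum_negf mult.assoc)
  qed
  finally show "(LINT x|lborel. of_real (gauss x) * ch (\<xi> \<bullet> x)) = of_real (exp (- (2 * pi\<^sup>2 * (norm \<xi>)\<^sup>2)))" .
qed

lemma integrable_gauss: "integrable lborel (\<lambda>x::'a::euclidean_space. complex_of_real (gauss x))"
  using gauss_ch(1)[of 0] by simp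

text \<open>Testing against Gaussians centred at a point where \<open>h\<close> does not vanish: as they concentrate,
  the contribution of a small ball dominates.\<close>
lemma fourier_injective:
  fixes h :: "real^'n::finite \<Rightarrow> complex"
  assumes cont: "continuous_on UNIV h" and int: "integrable lborel h"
    and zero: "\<And>z. (LINT s|lborel. h s * ch (z \<bullet> s)) = 0"
  shows "h s0 = 0"
proof (rule ccontr)
  assume nz: "h s0 \<noteq> 0"
  \<comment> \<open>Multiplying by the conjugate of \<open>h s0\<close> makes the value at
    \<open>s0\<close> a positive real, so the real part has a definite sign nearby.\<close>
  define k where "k s = Re (h s * cnj (h s0))" for s
  define c where "c = (norm (h s0))\<^sup>2 / 2"
  have c: "0 < c"
    using nz by (simp add: c_def)
  have k0: "k s0 = 2 * c"
    unfolding c_def cmod_power2 by (simp add: k_def power2_eq_square)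
  have ik: "integrable lborel k"
    unfolding k_def using int by (intro integrable_Re integrable_mult_left) auto
  have "continuous_on UNIV k"
    unfolding k_def by (intro continuous_intros cont)
  then have "isCont k s0"
    by (simp add: continuous_on_eq_continuous_at)
  then obtain r where r: "0 < r" "\<And>s. dist s s0 < r \<Longrightarrow> \<bar>k s - k s0\<bar> < c"
    using c unfolding continuous_at_eps_delta dist_real_def by metis
  have k_ge: "c \<le> k s" if "dist s s0 < r" for s
    using r(2)[OF that] k0 by linarith
  \<comment> \<open>Integrate the hypothesis against a Gaussian in \<open>z\<close>, modulated so
    that its transform is centred at \<open>s0\<close>, and exchange the integrals. The dilation
    \<open>l\<close> is chosen to give this transform the exponent \<open>a\<close>.\<close>
  have gauss_zero: "(LINT s|lborel. k s * exp (- (a * (norm (s - s0))\<^sup>2))) = 0" if a: "0 < a" for a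
  proof -
    define l where "l = sqrt (a / (2 * pi\<^sup>2))"
    have l2: "2 * pi\<^sup>2 * l\<^sup>2 = a"
      using a by (simp add: l_def)
    define A where "A z = of_real (gauss z) * ch (- (l * (z \<bullet> s0)))" for z :: "real^'n"
    have A: "integrable lborel A"
      unfolding A_def by (intro integrable_mult_ch integrable_gauss) simp
    have "0 = (LINT z|lborel. A z * (LINT s|lborel. h s * ch ((l *\<^sub>R z) \<bullet> s)))"
      by (simp only: zero mult_zero_right integral_zero)
    also have "\<dots> = (LINT z|lborel. LINT s|lborel. A z * h s * ch (l * (z \<bullet> s)))"
      by (simp add: mult.assoc)
    also have "\<dots> = (LINT s|lborel. LINT z|lborel. A z * h s * ch (l * (z \<bullet> s)))"
      by (rule lborel_Fubini_ch[OF A int])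
    also have "\<dots> = (LINT s|lborel. h s * of_real (exp (- (a * (norm (s - s0))\<^sup>2))))"
    proof (rule Bochner_Integration.integral_cong)
      fix s
      have "A z * h s * ch (l * (z \<bullet> s)) = h s * (of_real (gauss z) * ch ((l *\<^sub>R (s - s0)) \<bullet> z))" for z
      proof -
        have "ch (- (l * (z \<bullet> s0))) * ch (l * (z \<bullet> s)) = ch ((l *\<^sub>R (s - s0)) \<bullet> z)"
          unfolding ch_add [symmetric]
          by (rule arg_cong[of _ _ ch]) (simp add: inner_simps inner_commute algebra_simps)
        then show ?thesis
          by (simp add: A_def mult_ac)
      qed
      then have "(LINT z|lborel. A z * h s * ch (l * (z \<bullet> s)))
          = h s * (LINT z|lborel. of_real (gauss z) * ch ((l *\<^sub>R (s - s0)) \<bullet> z))"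
        by (simp only: integral_mult_right_zero)
      also have "\<dots> = h s * of_real (exp (- (2 * pi\<^sup>2 * (norm (l *\<^sub>R (s - s0)))\<^sup>2)))"
        by (simp only: gauss_ch)
      also have "2 * pi\<^sup>2 * (norm (l *\<^sub>R (s - s0)))\<^sup>2 = a * (norm (s - s0))\<^sup>2"
        by (simp add: power_mult_distrib flip: l2)
      finally show "(LINT z|lborel. A z * h s * ch (l * (z \<bullet> s))) = h s * of_real (exp (- (a * (norm (s - s0))\<^sup>2)))" .
    qed simp
    finally have z: "(LINT s|lborel. h s * of_real (exp (- (a * (norm (s - s0))\<^sup>2)))) = 0"
      by simp
    have "integrable lborel (\<lambda>s. h s * of_real (exp (- (a * (norm (s - s0))\<^sup>2))))"
      by (rule Bochner_Integration.integrable_bound[OF int])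
         (use int a in \<open>auto simp: norm_mult intro!: mult_left_le\<close>)
    then have "Re (LINT s|lborel. h s * of_real (exp (- (a * (norm (s - s0))\<^sup>2))) * cnj (h s0))
        = (LINT s|lborel. Re (h s * of_real (exp (- (a * (norm (s - s0))\<^sup>2))) * cnj (h s0)))"
      by (intro integral_Re[symmetric] integrable_mult_left) auto
    also have "\<dots> = (LINT s|lborel. k s * exp (- (a * (norm (s - s0))\<^sup>2)))"
      by (intro Bochner_Integration.integral_cong) (auto simp: k_def algebra_simps)
    finally show ?thesis
      using z by simp
  qed
  define V where "V = measure lborel (ball s0 (r / 2))"
  have V: "0 < V"
    unfolding V_def using r(1) by (simp add: content_ball_pos)
  define M where "M = (LINT s|lborel. \<bar>k s\<bar>)"
  \<comment> \<open>Makes \<open>a * (3 * r^2 / 4)\<close> exceed \<open>M / (c * V)\<close>. The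
    number 3 r^2 / 4 is r^2 - (r/2)^2, the difference between the exponents at radius
    \<open>r\<close> and at radius \<open>r / 2\<close>.\<close>
  define a where "a = (M / (c * V)) / (3 * r\<^sup>2 / 4) + 1"
  have M0: "0 \<le> M"
    unfolding M_def by (intro Bochner_Integration.integral_nonneg) auto
  have iB: "integrable lborel (indicat_real (ball s0 (r / 2)))"
    by (rule integrable_real_indicator) (use emeasure_lborel_ball_finite[of s0 "r / 2"] in auto)
  have a: "0 < a"
    unfolding a_def using M0 c V by (intro add_nonneg_pos divide_nonneg_nonneg) auto
  let ?e = "exp (- (a * (r / 2)\<^sup>2))" and ?e' = "exp (- (a * r\<^sup>2))"
  \<comment> \<open>Pointwise minorant: on the ball of radius \<open>r / 2\<close> the integrand is
    at least \<open>c * ?e\<close>, on the shell up to radius \<open>r\<close> it is non-negative,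
    and beyond that it is at least \<open>- ?e' * \<bar>k s\<bar>\<close>.\<close>
  have "(LINT s|lborel. c * ?e * indicator (ball s0 (r / 2)) s - ?e' * \<bar>k s\<bar>)
      \<le> (LINT s|lborel. k s * exp (- (a * (norm (s - s0))\<^sup>2)))"
  proof (rule integral_mono)
    show "integrable lborel (\<lambda>s. c * ?e * indicator (ball s0 (r / 2)) s - ?e' * \<bar>k s\<bar>)"
      using ik iB by (intro Bochner_Integration.integrable_diff integrable_mult_right integrable_abs) auto
    show "integrable lborel (\<lambda>s. k s * exp (- (a * (norm (s - s0))\<^sup>2)))"
      by (rule Bochner_Integration.integrable_bound[OF ik])
         (use ik a in \<open>auto simp: abs_mult intro!: mult_left_le\<close>)
    fix s
    let ?x = "exp (- (a * (norm (s - s0))\<^sup>2))"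
    have mono: "exp (- (a * v\<^sup>2)) \<le> exp (- (a * u\<^sup>2))" if "0 \<le> u" "u \<le> v" for u v
      using that a by (simp add: power_mono)
    have norm_eq: "norm (s - s0) = dist s s0"
      by (simp add: dist_norm)
    consider "dist s s0 < r / 2" | "r / 2 \<le> dist s s0" "dist s s0 < r" | "r \<le> dist s s0"
      by linarith
    then show "c * ?e * indicator (ball s0 (r / 2)) s - ?e' * \<bar>k s\<bar> \<le> k s * ?x"
    proof cases
      case 1
      then have "c * ?e \<le> k s * ?x"
        using c r(1) k_ge[of s] mono[of "norm (s - s0)" "r / 2"] norm_eq by (intro mult_mono) auto
      then show ?thesis
        using 1 by (simp add: dist_commute) (smt (verit) exp_gt_zero mult_nonneg_nonneg abs_ge_zero)
    next
      case 2
      then have "0 \<le> k s * ?x"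
        using c k_ge[of s] by (intro mult_nonneg_nonneg) auto
      then show ?thesis
        using 2 by (simp add: dist_commute) (smt (verit) exp_gt_zero mult_nonneg_nonneg abs_ge_zero)
    next
      case 3
      then have "?x * \<bar>k s\<bar> \<le> ?e' * \<bar>k s\<bar>"
        using r(1) mono[of r "norm (s - s0)"] norm_eq by (intro mult_right_mono) auto
      moreover have "- (?x * \<bar>k s\<bar>) \<le> k s * ?x"
        using mult_left_mono[of "- \<bar>k s\<bar>" "k s" ?x] by (simp add: mult.commute)
      ultimately show ?thesis
        using 3 r(1) by (simp add: dist_commute)
    qed
  qed
  also have "\<dots> = 0"
    by (rule gauss_zero[OF a])
  also have "(LINT s|lborel. c * ?e * indicator (ball s0 (r / 2)) s - ?e' * \<bar>k s\<bar>) = c * ?e * V - ?e' * M"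
    using ik iB by (subst Bochner_Integration.integral_diff) (auto simp: V_def M_def)
  finally have "c * V * ?e \<le> M * ?e'"
    by (simp add: mult_ac)
  then have "c * V * (?e * exp (a * r\<^sup>2)) \<le> M * (?e' * exp (a * r\<^sup>2))"
    using mult_right_mono[of "c * V * ?e" "M * ?e'" "exp (a * r\<^sup>2)"] by (simp add: mult_ac)
  then have le: "c * V * exp (a * (3 * r\<^sup>2 / 4)) \<le> M"
    by (simp add: power2_eq_square algebra_simps flip: exp_add)
  have "M / (c * V) < a * (3 * r\<^sup>2 / 4)"
    using r(1) by (simp add: a_def field_simps)
  also have "\<dots> < exp (a * (3 * r\<^sup>2 / 4))"
    using exp_ge_add_one_self[of "a * (3 * r\<^sup>2 / 4)"] by linarith
  finally have "M < c * V * exp (a * (3 * r\<^sup>2 / 4))"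
    using c V by (simp add: field_simps)
  with le show False
    by simp
qed

text \<open>At frequency 0, \<open>amb\<close> is an inverse Fourier integral of a chirp times the
  squared modulus of the transform of \<open>g\<close>. If it vanished identically, injectivity
  would make the transform of \<open>g\<close> zero, and injectivity once more would make
  \<open>g\<close> zero.\<close>

lemma amb_nonzero:
  fixes g :: "real^'n::finite \<Rightarrow> complex"
  assumes g: "g \<in> schwartz_class" and nz: "g \<noteq> (\<lambda>_. 0)"
  shows "\<exists>z. amb t g z 0 \<noteq> 0"
proof (rule ccontr)
  assume contra: "\<not> (\<exists>z. amb t g z 0 \<noteq> 0)"
  let ?G = "fourier_transform g"
  have contG: "continuous_on UNIV ?G"
    by (rule continuous_on_fourier_transform[OF schwartz_integrable[OF g]])
  have "chirp t s * ?G s * cnj (?G (s - 0)) = 0" for s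
  proof (rule fourier_injective[where h="\<lambda>s. chirp t s * ?G s * cnj (?G (s - 0))"])
    show "continuous_on UNIV (\<lambda>s. chirp t s * ?G s * cnj (?G (s - 0)))"
      by (intro continuous_intros continuous_on_compose2[OF contG]) auto
    show "integrable lborel (\<lambda>s. chirp t s * ?G s * cnj (?G (s - 0)))"
      by (rule amb_integrable[OF g])
    show "(LINT s|lborel. chirp t s * ?G s * cnj (?G (s - 0)) * ch (z \<bullet> s)) = 0" for z
      using contra unfolding amb_def by blast
  qed
  moreover have "chirp t s \<noteq> 0" for s :: "real^'n"
    using norm_chirp[of t s] by (metis norm_zero zero_neq_one)
  ultimately have G0: "?G s = 0" for s
    by simp
  have "g s = 0" for s
  proof (rule fourier_injective[where h=g])
    show "continuous_on UNIV g"
      using schwartz_differentiable[OF g, of "[]"] by (intro continuous_on_if_differentiable) simp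
    show "integrable lborel g"
      by (rule schwartz_integrable[OF g])
    show "(LINT s|lborel. g s * ch (z \<bullet> s)) = 0" for z
      using G0[of "- z"] by (simp add: fourier_transform_eq inner_commute)
  qed
  then show False
    using nz by auto
qed

subsection \<open>Mixed norms\<close>

text \<open>The exponent 1/p with 1/\<infinity> = 0, so that powers of \<open>K\<close> are written
  uniformly up to the endpoint.\<close>

definition recip :: "ennreal \<Rightarrow> real" where
  "recip p = enn2real (inverse p)"

lemma recip_top [simp]: "recip top = 0"
  by (simp add: recip_def)

lemma ennreal_ge_1_cases:
  assumes "1 \<le> (p::ennreal)" "p \<noteq> top"
  obtains P where "1 \<le> P" "p = ennreal P" "enn2real p = P" "recip p = 1 / P"
proof -
  obtain P where P: "p = ennreal P" "0 \<le> P"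
    using assms(2) by (cases p) auto
  with assms(1) have "1 \<le> P"
    by (simp flip: ennreal_1)
  with P that show ?thesis
    by (simp add: recip_def inverse_ennreal inverse_eq_divide)
qed

lemma recip_strict_antimono:
  assumes "1 \<le> p" "p < q"
  shows "recip q < recip p"
proof -
  obtain P where P: "1 \<le> P" "p = ennreal P" "recip p = 1 / P"
    using ennreal_ge_1_cases[OF assms(1)] assms(2) by (metis top.not_eq_extremum not_less_iff_gr_or_eq top_greatest less_le_not_le)
  show ?thesis
  proof (cases "q = top")
    case True
    then show ?thesis using P by simp
  next
    case False
    then obtain Q where Q: "1 \<le> Q" "q = ennreal Q" "recip q = 1 / Q"
      using ennreal_ge_1_cases[of q] assms by (metis less_imp_le order_trans)
    then have "P < Q"
      using assms(2) P by (simp add: ennreal_less_iff)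
    then show ?thesis
      using P Q by (simp add: frac_less2)
  qed
qed

lemma ennreal_powr_ennreal: "0 \<le> a \<Longrightarrow> ennreal_powr (ennreal a) r = ennreal (a powr r)"
  by (simp add: ennreal_powr_def)

lemma ennreal_powr_mono: "x \<le> y \<Longrightarrow> 0 \<le> r \<Longrightarrow> ennreal_powr x r \<le> ennreal_powr y r"
  unfolding ennreal_powr_def
  by (auto simp: top_unique intro!: ennreal_leI powr_mono2 enn2real_mono simp: less_top)

lemma measurable_ennreal_powr [measurable]: "(\<lambda>x. ennreal_powr x r) \<in> borel_measurable borel"
  unfolding ennreal_powr_def by measurable

text \<open>Interpolation between the sup bound and the integral: for finite exponents
  \<open>A x powr P\<close> is at most \<open>S powr (P - 1) * A x\<close>, and
  \<open>1 \<le> S\<close> allows the rounder constant \<open>S powr P\<close>. Measurability is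
  asked for only at \<open>p = top\<close>, since nonnegative integrals are monotone for arbitrary
  functions whereas an essential supremum is bounded above only for measurable ones.\<close>

lemma Lp_norm_le:
  fixes A :: "real^'n::finite \<Rightarrow> real"
  assumes p: "1 \<le> p" and meas: "p = top \<Longrightarrow> F \<in> borel_measurable borel"
    and F: "\<And>x. F x \<le> ennreal (c * A x)" and c: "0 \<le> c"
    and A: "\<And>x. 0 \<le> A x" "\<And>x. A x \<le> S" and S: "1 \<le> S"
    and int: "integrable lborel A" "(LINT x|lborel. A x) = J" and J: "0 < J"
  shows "Lp_norm p F \<le> ennreal (c * S * J powr recip p)"
proof (cases "p = top")
  case True
  have "F x \<le> ennreal (c * S)" for x
    by (rule order_trans[OF F]) (intro ennreal_leI mult_left_mono A c)
  then have "esssup lborel F \<le> ennreal (c * S)"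
    using meas[OF True] by (intro esssup_I) auto
  then show ?thesis
    using True J by (simp add: Lp_norm_def)
next
  case False
  then obtain P where P: "1 \<le> P" "enn2real p = P" "recip p = 1 / P"
    using ennreal_ge_1_cases[OF p] by metis
  have bound: "(c * A x) powr P \<le> (c * S) powr P * A x" for x
  proof -
    have "A x powr P = A x * A x powr (P - 1)"
      using powr_mult_base[of "A x" "P - 1"] A(1)[of x] by simp
    also have "\<dots> \<le> A x * S powr (P - 1)"
      using A P by (intro mult_left_mono powr_mono2) auto
    also have "\<dots> \<le> A x * S powr P"
      using A S by (intro mult_left_mono powr_mono) auto
    finally have "c powr P * A x powr P \<le> c powr P * (A x * S powr P)"
      by (intro mult_left_mono) auto
    then show ?thesis
      using c A(1)[of x] S by (simp add: powr_mult mult_ac)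
  qed
  have "(\<integral>\<^sup>+x. ennreal_powr (F x) P \<partial>lborel) \<le> (\<integral>\<^sup>+x. ennreal ((c * S) powr P * A x) \<partial>lborel)"
  proof (rule nn_integral_mono)
    fix x
    have "ennreal_powr (F x) P \<le> ennreal_powr (ennreal (c * A x)) P"
      using F P by (intro ennreal_powr_mono) auto
    also have "\<dots> = ennreal ((c * A x) powr P)"
      using c A by (intro ennreal_powr_ennreal) auto
    also have "\<dots> \<le> ennreal ((c * S) powr P * A x)"
      by (intro ennreal_leI bound)
    finally show "ennreal_powr (F x) P \<le> ennreal ((c * S) powr P * A x)" .
  qed
  also have "\<dots> = ennreal ((c * S) powr P * J)"
    using int A by (subst nn_integral_eq_integral) auto
  finally have "Lp_norm p F \<le> ennreal_powr (ennreal ((c * S) powr P * J)) (1 / P)"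
    using False P by (simp add: Lp_norm_def ennreal_powr_mono)
  also have "\<dots> = ennreal (((c * S) powr P * J) powr (1 / P))"
    using J by (intro ennreal_powr_ennreal) auto
  also have "((c * S) powr P * J) powr (1 / P) = c * S * J powr (1 / P)"
    using J P c S by (simp add: powr_mult powr_powr)
  finally show ?thesis
    using P by simp
qed

text \<open>Chebyshev's inequality; at \<open>p = top\<close> it says that a value attained on a set
  of positive measure bounds the essential supremum from below.\<close>

lemma Lp_norm_ge:
  fixes E :: "(real^'n::finite) set"
  assumes p: "1 \<le> p" and E: "E \<in> sets borel" "emeasure lborel E = ennreal m" and m: "0 < m"
    and F: "\<And>x. x \<in> E \<Longrightarrow> ennreal c \<le> F x" and c: "0 \<le> c"
  shows "ennreal (c * m powr recip p) \<le> Lp_norm p F"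
proof (cases "p = top")
  case True
  have "ennreal c \<le> esssup lborel F"
  proof (rule ccontr)
    assume "\<not> ennreal c \<le> esssup lborel F"
    moreover have "AE x in lborel. F x \<le> esssup lborel F"
      by (rule esssup_AE)
    ultimately have "AE x in lborel. x \<notin> E"
      by (auto elim!: eventually_mono dest: F)
    then have "emeasure lborel E = 0"
      using E(1) by (simp add: AE_iff_measurable[of E])
    with E m show False by simp
  qed
  then show ?thesis
    using True m by (simp add: Lp_norm_def)
next
  case False
  then obtain P where P: "1 \<le> P" "enn2real p = P" "recip p = 1 / P"
    using ennreal_ge_1_cases[OF p] by metis
  have "ennreal (c powr P * m) = (\<integral>\<^sup>+x. ennreal (c powr P) * indicator E x \<partial>lborel)"
    using E m by (subst nn_integral_cmult_indicator) (auto simp: ennreal_mult)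
  also have "\<dots> \<le> (\<integral>\<^sup>+x. ennreal_powr (F x) P \<partial>lborel)"
  proof (rule nn_integral_mono)
    fix x
    show "ennreal (c powr P) * indicator E x \<le> ennreal_powr (F x) P"
      using ennreal_powr_mono[OF F, of x P] P c by (auto simp: indicator_def ennreal_powr_ennreal)
  qed
  finally have "ennreal_powr (ennreal (c powr P * m)) (1 / P) \<le> Lp_norm p F"
    using False P by (simp add: Lp_norm_def ennreal_powr_mono)
  moreover have "ennreal_powr (ennreal (c powr P * m)) (1 / P) = ennreal (c * m powr (1 / P))"
    using m c P by (simp add: ennreal_powr_ennreal powr_mult powr_powr)
  ultimately show ?thesis
    using P by simp
qed

text \<open>At most one index k puts \<open>s * real k\<close> within |s|/2 of \<open>x $ i\<close>,
  and its term is at most 1. Every other term is at most 4/K because s^2/4 is at least K/4, so the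
  total is at most 1 + 4. It is \<open>real K \<le> \<bar>s\<bar>\<close> that makes the bound
  independent of \<open>K\<close>.\<close>

lemma sum_decay_separated:
  fixes x :: "real^'n::finite"
  assumes s: "1 \<le> \<bar>s\<bar>" "real K \<le> \<bar>s\<bar>"
  shows "(\<Sum>k<K. decay (x - (s * real k) *\<^sub>R axis i 1)) \<le> 5"
proof (cases "K = 0")
  case False
  let ?a = "\<lambda>k. x $ i - s * real k"
  have far: "decay (x - (s * real k) *\<^sub>R axis i 1) \<le> 4 / real K" if "\<bar>s\<bar> / 2 \<le> \<bar>?a k\<bar>" for k
  proof -
    have "real K * 1 \<le> \<bar>s\<bar> * \<bar>s\<bar>"
      using s by (intro mult_mono) auto
    then have "real K / 4 \<le> (\<bar>s\<bar> / 2)\<^sup>2"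
      by (simp add: power2_eq_square)
    also have "\<dots> \<le> \<bar>?a k\<bar>\<^sup>2"
      using that by (intro power_mono) auto
    finally have "real K / 4 \<le> 1 + (?a k)\<^sup>2"
      by simp
    then have "1 / (1 + (?a k)\<^sup>2) \<le> 1 / (real K / 4)"
      using False by (intro divide_left_mono) (auto intro!: mult_pos_pos add_pos_nonneg)
    then show ?thesis
      using decay_le_component[of "x - (s * real k) *\<^sub>R axis i 1" i] by simp
  qed
  have near_unique: "j = k" if "\<bar>?a j\<bar> < \<bar>s\<bar> / 2" "\<bar>?a k\<bar> < \<bar>s\<bar> / 2" for j k
  proof (rule ccontr)
    assume "j \<noteq> k"
    then have "1 \<le> \<bar>real k - real j\<bar>"
      by linarith
    then have "\<bar>s\<bar> * 1 \<le> \<bar>s\<bar> * \<bar>real k - real j\<bar>"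
      by (intro mult_left_mono) auto
    also have "\<dots> = \<bar>?a j - ?a k\<bar>"
      by (simp add: right_diff_distrib flip: abs_mult)
    finally show False
      using that by linarith
  qed
  \<comment> \<open>If no index is near, \<open>k0\<close> is an arbitrary number, and granting it
    the extra 1 does no harm.\<close>
  define k0 where "k0 = (SOME k. \<bar>?a k\<bar> < \<bar>s\<bar> / 2)"
  have "decay (x - (s * real k) *\<^sub>R axis i 1) \<le> (if k = k0 then 1 else 0) + 4 / real K" for k
  proof (cases "k = k0")
    case True
    then show ?thesis
      using decay_le_1[of "x - (s * real k) *\<^sub>R axis i 1"] by (simp add: add_increasing2)
  next
    case False
    have "\<not> \<bar>?a k\<bar> < \<bar>s\<bar> / 2"
      using False near_unique someI[of "\<lambda>k. \<bar>?a k\<bar> < \<bar>s\<bar> / 2" k] unfolding k0_def by blast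
    then show ?thesis
      using far[of k] False by simp
  qed
  then have "(\<Sum>k<K. decay (x - (s * real k) *\<^sub>R axis i 1)) \<le> (\<Sum>k<K. (if k = k0 then 1 else 0) + 4 / real K)"
    by (rule sum_mono)
  also have "\<dots> \<le> 5"
    using False by (simp add: sum.distrib)
  finally show ?thesis .
qed simp

lemma sum_decay_integral:
  fixes x :: "nat \<Rightarrow> real^'n::finite"
  shows "integrable lborel (\<lambda>y. \<Sum>k<K. decay (y - x k))"
    and "(LINT y|lborel. (\<Sum>k<K. decay (y - x k))) = real K * (LINT y|lborel. decay (y :: real^'n))"
proof -
  have int: "integrable lborel (\<lambda>y. decay (y - x k))" for k
    using lborel_integrable_translate[OF integrable_decay, of "- x k"] by simp
  have "(LINT y|lborel. decay (y - x k)) = (LINT y|lborel. decay (y :: real^'n))" for k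
    using lborel_integral_translate[of decay "- x k"] by simp
  then show "(LINT y|lborel. (\<Sum>k<K. decay (y - x k))) = real K * (LINT y|lborel. decay (y :: real^'n))"
    using int by (subst Bochner_Integration.integral_sum) auto
  show "integrable lborel (\<lambda>y. \<Sum>k<K. decay (y - x k))"
    using int by auto
qed

lemma integral_decay_pos: "0 < (LINT y|lborel. decay (y :: real^'n::finite))"
proof -
  have "0 \<le> (LINT y|lborel. decay (y :: real^'n))"
    by (intro Bochner_Integration.integral_nonneg) auto
  moreover have "(LINT y|lborel. decay (y :: real^'n)) \<noteq> 0"
  proof
    assume "(LINT y|lborel. decay (y :: real^'n)) = 0"
    then have "AE y in lborel. decay (y :: real^'n) = 0"
      by (subst (asm) integral_nonneg_eq_0_iff_AE) (auto intro: integrable_decay)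
    then have "AE y in (lborel :: (real^'n) measure). False"
      by (auto elim!: eventually_mono simp: less_imp_neq[OF decay_pos, symmetric])
    then show False
      using AE_iff_measurable[of UNIV "lborel :: (real^'n) measure" "\<lambda>_. False"] by simp
  qed
  ultimately show ?thesis by linarith
qed

lemma emeasure_ball_content:
  fixes w :: "real^'n::finite"
  assumes "0 < r"
  shows "emeasure lborel (ball w r) = ennreal (measure lborel (ball (0::real^'n) r))"
proof -
  have "emeasure lborel (ball w r) = emeasure lborel (ball (0::real^'n) r)"
    using assms by (simp add: emeasure_ball)
  also have "\<dots> = ennreal (measure lborel (ball (0::real^'n) r))"
    using emeasure_lborel_ball_finite[of "0::real^'n" r] by (intro emeasure_eq_ennreal_measure) auto
  finally show ?thesis .
qed

lemma emeasure_separated_balls: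
  fixes w :: "real^'n::finite"
  assumes r: "0 < r" and s: "2 * r \<le> \<bar>s\<bar>"
  shows "emeasure lborel (\<Union>k<K. ball (w + (s * real k) *\<^sub>R axis i 1) r)
    = ennreal (real K * measure lborel (ball (0::real^'n) r))"
proof -
  have "disjoint_family_on (\<lambda>k. ball (w + (s * real k) *\<^sub>R axis i 1) r) {..<K}"
    unfolding disjoint_family_on_def
  proof (intro ballI impI)
    fix j k :: nat assume "j \<noteq> k"
    then have "1 \<le> \<bar>real j - real k\<bar>"
      by linarith
    then have "\<bar>s\<bar> * 1 \<le> \<bar>s\<bar> * \<bar>real j - real k\<bar>"
      by (intro mult_left_mono) auto
    also have "\<dots> = dist (w + (s * real j) *\<^sub>R axis i 1) (w + (s * real k) *\<^sub>R axis i (1::real))"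
      by (simp add: dist_norm abs_mult flip: scaleR_diff_left right_diff_distrib)
    finally have "r + r \<le> dist (w + (s * real j) *\<^sub>R axis i 1) (w + (s * real k) *\<^sub>R axis i (1::real))"
      using s by linarith
    then show "ball (w + (s * real j) *\<^sub>R axis i 1) r \<inter> ball (w + (s * real k) *\<^sub>R axis i 1) r = {}"
      by (rule disjoint_ballI)
  qed
  then have "emeasure lborel (\<Union>k<K. ball (w + (s * real k) *\<^sub>R axis i 1) r)
      = (\<Sum>k<K. emeasure lborel (ball (w + (s * real k) *\<^sub>R axis i 1) r))"
    by (intro sum_emeasure[symmetric]) auto
  also have "\<dots> = (\<Sum>k<K. ennreal (measure lborel (ball (0::real^'n) r)))"
    using r by (simp only: emeasure_ball_content)
  also have "\<dots> = ennreal (real K * measure lborel (ball (0::real^'n) r))"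
    by (simp add: ennreal_of_nat_eq_real_of_nat ennreal_mult)
  finally show ?thesis .
qed

lemma measurable_stft:
  fixes f g :: "real^'n::finite \<Rightarrow> complex"
  assumes [measurable]: "f \<in> borel_measurable borel" "g \<in> borel_measurable borel"
  shows "(\<lambda>(z, \<zeta>). stft g f z \<zeta>) \<in> borel_measurable (borel \<Otimes>\<^sub>M borel)"
  unfolding stft_eq fourier_transform_eq by measurable

subsection \<open>Norms of sums of time-frequency shifts\<close>

lemma sum_shifts_stft_le:
  fixes g :: "real^'n::finite \<Rightarrow> complex"
  assumes g: "g \<in> schwartz_class" and C: "\<And>z \<zeta>. norm (stft g g z \<zeta>) \<le> C * decay z * decay \<zeta>"
  shows "norm (stft g (\<lambda>y. \<Sum>k<K. ch (\<eta> k \<bullet> y) * g (y - x k)) z \<zeta>)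
    \<le> C * (\<Sum>k<K. decay (z - x k) * decay (\<zeta> - \<eta> k))"
proof -
  have "norm (stft g (\<lambda>y. \<Sum>k<K. ch (\<eta> k \<bullet> y) * g (y - x k)) z \<zeta>)
      \<le> (\<Sum>k<K. norm (stft g g (z - x k) (\<zeta> - \<eta> k)))"
    by (rule norm_stft_sum_shifts_le[OF g])
  also have "\<dots> \<le> (\<Sum>k<K. C * decay (z - x k) * decay (\<zeta> - \<eta> k))"
    by (intro sum_mono C)
  finally show ?thesis
    by (simp add: sum_distrib_left mult.assoc)
qed

lemma measurable_sum_shifts_stft:
  fixes g :: "real^'n::finite \<Rightarrow> complex"
  assumes g: "g \<in> schwartz_class"
  shows "(\<lambda>(z, \<zeta>). stft g (\<lambda>y. \<Sum>k<K. ch (\<eta> k \<bullet> y) * g (y - x k)) z \<zeta>)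
    \<in> borel_measurable (borel \<Otimes>\<^sub>M borel)"
proof -
  have [measurable]: "g \<in> borel_measurable borel"
    using schwartz_measurable[OF g, of "[]"] by simp
  show ?thesis
    by (rule measurable_stft) measurable
qed

text \<open>All pieces sit over time 0, so the bound factors into \<open>decay z\<close> and a
  separated sum in frequency; only the inner norm sees \<open>K\<close>. The exponent
  \<open>q\<close> is finite so that no measurability in \<open>z\<close> has to be shown.\<close>

lemma amalgam_norm_modulations_le:
  fixes g :: "real^'n::finite \<Rightarrow> complex"
  assumes g: "g \<in> schwartz_class" and C: "0 \<le> C" "\<And>z \<zeta>. norm (stft g g z \<zeta>) \<le> C * decay z * decay \<zeta>"
    and p: "1 \<le> p" and q: "1 \<le> q" "q \<noteq> top" and K: "0 < K"
    and N: "1 \<le> N" "real K \<le> N"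
  defines "I \<equiv> LINT y|lborel. decay (y :: real^'n)"
  shows "wiener_amalgam_norm g p q (\<lambda>y. \<Sum>k<K. ch (((N * real k) *\<^sub>R axis i 1) \<bullet> y) * g (y - 0))
    \<le> ennreal (C * 5 * (real K * I) powr recip p * I powr recip q)"
proof -
  define \<eta> where "\<eta> k = (N * real k) *\<^sub>R axis i (1::real)" for k :: nat
  define f where "f y = (\<Sum>k<K. ch (\<eta> k \<bullet> y) * g (y - 0))" for y
  have I: "0 < I"
    unfolding I_def by (rule integral_decay_pos)
  have sep: "(\<Sum>k<K. decay (\<zeta> - \<eta> k)) \<le> 5" for \<zeta> :: "real^'n"
    unfolding \<eta>_def using N by (intro sum_decay_separated) auto
  have [measurable]: "(\<lambda>(z, \<zeta>). stft g f z \<zeta>) \<in> borel_measurable (borel \<Otimes>\<^sub>M borel)"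
    unfolding f_def by (rule measurable_sum_shifts_stft[OF g])
  have meas: "(\<lambda>\<zeta>. ennreal (norm (stft g f z \<zeta>))) \<in> borel_measurable borel" for z
    by measurable
  have inner: "Lp_norm p (\<lambda>\<zeta>. ennreal (norm (stft g f z \<zeta>)))
      \<le> ennreal ((C * decay z) * 5 * (real K * I) powr recip p)" for z
  proof (rule Lp_norm_le[OF p meas])
    show "ennreal (norm (stft g f z \<zeta>)) \<le> ennreal ((C * decay z) * (\<Sum>k<K. decay (\<zeta> - \<eta> k)))" for \<zeta>
      using sum_shifts_stft_le[OF g C(2), where K=K and \<eta>=\<eta> and x="\<lambda>_. 0" and z=z and \<zeta>=\<zeta>] unfolding f_def
      by (intro ennreal_leI) (simp add: mult.assoc flip: sum_distrib_left)
    show "integrable lborel (\<lambda>\<zeta>. \<Sum>k<K. decay (\<zeta> - \<eta> k))"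
      by (rule sum_decay_integral)
    show "(LINT \<zeta>|lborel. (\<Sum>k<K. decay (\<zeta> - \<eta> k))) = real K * I"
      unfolding I_def by (rule sum_decay_integral)
  qed (use C sep K I in \<open>auto intro!: sum_nonneg\<close>)
  have "Lp_norm q (\<lambda>z. Lp_norm p (\<lambda>\<zeta>. ennreal (norm (stft g f z \<zeta>))))
      \<le> ennreal ((C * 5 * (real K * I) powr recip p) * 1 * I powr recip q)"
  proof (rule Lp_norm_le[OF q(1)])
    show "Lp_norm p (\<lambda>\<zeta>. ennreal (norm (stft g f z \<zeta>)))
        \<le> ennreal ((C * 5 * (real K * I) powr recip p) * decay z)" for z
      using inner[of z] by (simp add: mult_ac)
  qed (use q(2) C I in \<open>auto simp: decay_le_1 integrable_decay I_def\<close>)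
  then show ?thesis
    unfolding wiener_amalgam_norm_def f_def [abs_def] \<eta>_def by (simp only: mult_1_right)
qed

text \<open>At a fixed time \<open>z\<close> the frequency bumps carry the weights
  \<open>decay (z - t *\<^sub>R \<eta> k)\<close>, whose total \<open>G z\<close> is at most 5 by
  separation in time. The inner norm is therefore at most a multiple of \<open>G z\<close>, free of
  \<open>K\<close>, and \<open>K\<close> enters only through the integral of
  \<open>G\<close>.\<close>

lemma amalgam_norm_shifts_le:
  fixes g :: "real^'n::finite \<Rightarrow> complex"
  assumes g: "g \<in> schwartz_class" and C: "0 \<le> C" "\<And>z \<zeta>. norm (stft g g z \<zeta>) \<le> C * decay z * decay \<zeta>"
    and p: "1 \<le> p" "p \<noteq> top" and q: "1 \<le> q" and K: "0 < K"
    and N: "1 \<le> \<bar>t * N\<bar>" "real K \<le> \<bar>t * N\<bar>"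
  defines "I \<equiv> LINT y|lborel. decay (y :: real^'n)"
  shows "wiener_amalgam_norm g p q (\<lambda>y. \<Sum>k<K. ch (((N * real k) *\<^sub>R axis i 1) \<bullet> y)
      * g (y - t *\<^sub>R ((N * real k) *\<^sub>R axis i 1)))
    \<le> ennreal (C * I powr recip p * 5 * (real K * I) powr recip q)"
proof -
  define \<eta> where "\<eta> k = (N * real k) *\<^sub>R axis i (1::real)" for k :: nat
  define f where "f y = (\<Sum>k<K. ch (\<eta> k \<bullet> y) * g (y - t *\<^sub>R \<eta> k))" for y
  define G where "G z = (\<Sum>k<K. decay (z - t *\<^sub>R \<eta> k))" for z
  have I: "0 < I"
    unfolding I_def by (rule integral_decay_pos)
  have G0: "0 < G z" for z
    unfolding G_def using K by (intro sum_pos) auto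
  have sep: "G z \<le> 5" for z :: "real^'n"
    unfolding G_def \<eta>_def using sum_decay_separated[OF N, of z i] by (simp add: mult_ac)
  have joint [measurable]: "(\<lambda>(z, \<zeta>). stft g f z \<zeta>) \<in> borel_measurable (borel \<Otimes>\<^sub>M borel)"
    unfolding f_def by (rule measurable_sum_shifts_stft[OF g])
  have inner: "Lp_norm p (\<lambda>\<zeta>. ennreal (norm (stft g f z \<zeta>)))
      \<le> ennreal ((C * G z) * 1 * I powr recip p)" for z
  proof (rule Lp_norm_le[OF p(1)])
    \<comment> \<open>A convex combination of translates of \<open>decay\<close>: bounded by 1 with
      integral \<open>I\<close>, whatever \<open>K\<close> is.\<close>
    let ?A = "\<lambda>\<zeta>. (\<Sum>k<K. decay (z - t *\<^sub>R \<eta> k) * decay (\<zeta> - \<eta> k)) / G z"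
    show "ennreal (norm (stft g f z \<zeta>)) \<le> ennreal ((C * G z) * ?A \<zeta>)" for \<zeta>
      using sum_shifts_stft_le[OF g C(2), where K=K and \<eta>=\<eta> and x="\<lambda>k. t *\<^sub>R \<eta> k" and z=z and \<zeta>=\<zeta>] G0[of z] unfolding f_def
      by (intro ennreal_leI) simp
    show "0 \<le> ?A \<zeta>" for \<zeta>
      using G0[of z] by (intro divide_nonneg_pos sum_nonneg mult_nonneg_nonneg) auto
    have "(\<Sum>k<K. decay (z - t *\<^sub>R \<eta> k) * decay (\<zeta> - \<eta> k)) \<le> G z" for \<zeta>
      unfolding G_def by (intro sum_mono mult_left_le) (auto simp: decay_le_1)
    then show "?A \<zeta> \<le> 1" for \<zeta>
      using G0[of z] by simp
    have int: "integrable lborel (\<lambda>\<zeta>. decay (\<zeta> - \<eta> k))" for k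
      using lborel_integrable_translate[OF integrable_decay, of "- \<eta> k"] by simp
    then show "integrable lborel ?A"
      by (intro integrable_divide Bochner_Integration.integrable_sum integrable_mult_right)
    have "(LINT \<zeta>|lborel. decay (\<zeta> - \<eta> k)) = I" for k
      using lborel_integral_translate[of decay "- \<eta> k"] by (simp add: I_def)
    then have "(LINT \<zeta>|lborel. (\<Sum>k<K. decay (z - t *\<^sub>R \<eta> k) * decay (\<zeta> - \<eta> k))) = G z * I"
      unfolding G_def using int by (subst Bochner_Integration.integral_sum) (auto simp: sum_distrib_right)
    then show "(LINT \<zeta>|lborel. ?A \<zeta>) = I"
      using G0[of z] by simp
  qed (use C G0 I p(2) in \<open>auto simp: less_imp_le\<close>)
  have "Lp_norm q (\<lambda>z. Lp_norm p (\<lambda>\<zeta>. ennreal (norm (stft g f z \<zeta>))))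
      \<le> ennreal ((C * I powr recip p) * 5 * (real K * I) powr recip q)"
  proof (rule Lp_norm_le[OF q])
    \<comment> \<open>Since \<open>p\<close> is finite, the inner norm is a power of a parameter
      integral of a jointly measurable function. This matters when \<open>q = top\<close>.\<close>
    show "(\<lambda>z. Lp_norm p (\<lambda>\<zeta>. ennreal (norm (stft g f z \<zeta>)))) \<in> borel_measurable borel"
      using p(2) unfolding Lp_norm_def by simp
    show "Lp_norm p (\<lambda>\<zeta>. ennreal (norm (stft g f z \<zeta>))) \<le> ennreal ((C * I powr recip p) * G z)" for z
      using inner[of z] by (simp add: mult_ac)
    show "0 \<le> G z" for z
      using G0[of z] by simp
    show "integrable lborel G"
      unfolding G_def by (rule sum_decay_integral)
    show "(LINT z|lborel. G z) = real K * I"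
      unfolding G_def I_def by (rule sum_decay_integral)
  qed (use C I K sep in auto)
  then show ?thesis
    unfolding wiener_amalgam_norm_def f_def [abs_def] \<eta>_def .
qed

text \<open>The bound reads \<open>2 * c\<close> because one \<open>c\<close> will be given up to
  the interference of the other pieces. Continuity loses at most \<open>2 * c\<close> from the value
  \<open>4 * c\<close> at the centre.\<close>

lemma amb_lower_bound:
  fixes g :: "real^'n::finite \<Rightarrow> complex"
  assumes g: "g \<in> schwartz_class" and nz: "g \<noteq> (\<lambda>_. 0)"
  shows "\<exists>z0 c r. 0 < c \<and> 0 < r \<and> (\<forall>z\<in>ball z0 r. \<forall>\<zeta>\<in>ball 0 r. 2 * c \<le> norm (amb t g z \<zeta>))"
proof -
  obtain z0 where z0: "amb t g z0 0 \<noteq> 0"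
    using amb_nonzero[OF g nz] by blast
  define c where "c = norm (amb t g z0 0) / 4"
  have c: "0 < c"
    using z0 by (simp add: c_def)
  have "isCont (\<lambda>p. norm (amb t g (fst p) (snd p))) (z0, 0)"
    using continuous_on_norm[OF continuous_on_amb[OF g]] by (simp add: continuous_on_eq_continuous_at)
  then obtain \<delta> where \<delta>: "0 < \<delta>"
    "\<And>p. dist p (z0, 0) < \<delta> \<Longrightarrow> \<bar>norm (amb t g (fst p) (snd p)) - norm (amb t g z0 0)\<bar> < 2 * c"
    unfolding continuous_at_eps_delta dist_real_def using c
    by (metis fst_conv snd_conv mult_pos_pos zero_less_numeral)
  have "2 * c \<le> norm (amb t g z \<zeta>)" if "z \<in> ball z0 (\<delta> / 2)" "\<zeta> \<in> ball 0 (\<delta> / 2)" for z \<zeta>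
  proof -
    have "dist (z, \<zeta>) (z0, 0) \<le> dist z z0 + dist \<zeta> 0"
      unfolding dist_prod_def by (rule order_trans[OF sqrt_sum_squares_le_sum]) auto
    also have "\<dots> < \<delta>"
      using that by (simp add: dist_commute)
    finally have "\<bar>norm (amb t g z \<zeta>) - norm (amb t g z0 0)\<bar> < 2 * c"
      using \<delta>(2)[of "(z, \<zeta>)"] by simp
    moreover have "norm (amb t g z0 0) = 4 * c"
      by (simp add: c_def)
    ultimately show ?thesis by linarith
  qed
  then show ?thesis
    using c \<delta>(1) by (intro exI[of _ z0] exI[of _ c] exI[of _ "\<delta> / 2"]) auto
qed

text \<open>The pieces of the transformed sum interact only weakly, because \<open>amb\<close> decays in the
  frequency variable.\<close>
lemma stft_multiplier_lower_bound:
  fixes g :: "real^'n::finite \<Rightarrow> complex" and x :: "nat \<Rightarrow> real^'n" and i :: 'n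
  assumes g: "g \<in> schwartz_class"
    and c: "0 < c" "\<And>z \<zeta>. z \<in> ball z0 r \<Longrightarrow> \<zeta> \<in> ball 0 r \<Longrightarrow> 2 * c \<le> norm (amb t g z \<zeta>)"
    and D: "0 \<le> D" "\<And>z \<zeta> i. norm (amb t g z \<zeta>) \<le> D / (1 + (\<zeta> $ i / 2)\<^sup>2)"
    and N: "1 \<le> N" "2 * r \<le> N" "16 * D * real K / c \<le> N" and k: "k < K"
  defines "\<eta> \<equiv> \<lambda>k. (N * real k) *\<^sub>R axis i (1::real)"
  assumes z: "z + t *\<^sub>R \<eta> k - x k \<in> ball z0 r" and \<zeta>: "\<zeta> - \<eta> k \<in> ball 0 r"
  shows "c \<le> norm (stft g (\<lambda>y. LINT \<xi>|lborel. ch (y \<bullet> \<xi>)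
    * (chirp t \<xi> * fourier_transform (\<lambda>y. \<Sum>k<K. ch (\<eta> k \<bullet> y) * g (y - x k)) \<xi>)) z \<zeta>)"
proof -
  define v where "v j = chirp t (\<eta> j) * ch (- (z \<bullet> (\<zeta> - \<eta> j))) * amb t g (z + t *\<^sub>R \<eta> j - x j) (\<zeta> - \<eta> j)" for j
  \<comment> \<open>At most K - 1 such terms add up to at most \<open>c\<close>, which leaves
    \<open>2 * c - c\<close> for the main one.\<close>
  have small: "norm (v j) \<le> c / real K" if "j \<noteq> k" for j
  proof -
    have "\<bar>(\<zeta> - \<eta> k) $ i\<bar> < r"
      using \<zeta> component_le_norm_cart[of "\<zeta> - \<eta> k" i] by simp
    moreover have "1 \<le> \<bar>real k - real j\<bar>"
      using that by linarith
    then have "N * 1 \<le> N * \<bar>real k - real j\<bar>"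
      using N(1) by (intro mult_left_mono) auto
    then have "N \<le> \<bar>N * real k - N * real j\<bar>"
      using N(1) by (simp add: abs_mult flip: right_diff_distrib)
    moreover have "(\<zeta> - \<eta> j) $ i = (\<zeta> - \<eta> k) $ i + (N * real k - N * real j)"
      by (simp add: \<eta>_def)
    ultimately have "N / 2 \<le> \<bar>(\<zeta> - \<eta> j) $ i\<bar>"
      using N(2) by linarith
    then have "(N / 4)\<^sup>2 \<le> \<bar>(\<zeta> - \<eta> j) $ i / 2\<bar>\<^sup>2"
      using N(1) by (intro power_mono) auto
    \<comment> \<open>Since \<open>1 \<le> N\<close>, one power of \<open>N\<close> may be dropped.
      The remaining bound 16 D / N is at most c / K by the third condition on
      \<open>N\<close>.\<close>
    moreover have "N / 16 \<le> (N / 4)\<^sup>2"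
      using N(1) mult_right_mono[of 1 N N] by (simp add: power2_eq_square)
    ultimately have N16: "N / 16 \<le> 1 + ((\<zeta> - \<eta> j) $ i / 2)\<^sup>2"
      by (simp only: power2_abs)
    have "norm (v j) \<le> D / (1 + ((\<zeta> - \<eta> j) $ i / 2)\<^sup>2)"
      unfolding v_def norm_mult norm_chirp norm_ch mult_1 by (rule D)
    also have "\<dots> \<le> D / (N / 16)"
      using N16 N(1) D(1) by (intro divide_left_mono mult_pos_pos add_pos_nonneg) auto
    also have "\<dots> \<le> c / real K"
      using N k c(1) by (simp add: field_simps)
    finally show ?thesis .
  qed
  have "norm (\<Sum>j\<in>{..<K} - {k}. v j) \<le> (\<Sum>j\<in>{..<K} - {k}. c / real K)"
    by (intro order_trans[OF norm_sum] sum_mono small) auto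
  also have "\<dots> \<le> (\<Sum>j<K. c / real K)"
    using c(1) by (intro sum_mono2) auto
  also have "\<dots> = c"
    using k by simp
  finally have "norm (\<Sum>j\<in>{..<K} - {k}. v j) \<le> c" .
  moreover have "2 * c \<le> norm (v k)"
    unfolding v_def norm_mult norm_chirp norm_ch mult_1 using c(2)[OF z \<zeta>] .
  moreover have "(\<Sum>j<K. v j) = v k + (\<Sum>j\<in>{..<K} - {k}. v j)"
    using k by (intro sum.remove) auto
  ultimately have "c \<le> norm (\<Sum>j<K. v j)"
    using norm_triangle_ineq4[of "\<Sum>j<K. v j" "\<Sum>j\<in>{..<K} - {k}. v j"] by simp
  then show ?thesis
    unfolding v_def stft_multiplier_sum_shifts[OF g] .
qed

section \<open>Contradiction by growth in the number of pieces\<close>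

lemma powr_unbounded:
  assumes "b < (a::real)" "0 < \<alpha>"
  shows "\<exists>K>0. \<beta> * real K powr b < \<alpha> * real K powr a"
proof -
  define M where "M = max 1 (\<beta> / \<alpha>)"
  obtain K :: nat where K: "M powr (1 / (a - b)) < real K"
    using reals_Archimedean2 by blast
  have M: "1 \<le> M" "\<beta> / \<alpha> \<le> M"
    by (auto simp: M_def)
  have K0: "0 < K"
    using K M(1) by (cases "K = 0") (auto simp: not_less)
  have "M = (M powr (1 / (a - b))) powr (a - b)"
    using M assms by (simp add: powr_powr)
  also have "\<dots> < real K powr (a - b)"
    using K assms by (intro powr_less_mono2) auto
  finally have "\<beta> / \<alpha> < real K powr (a - b)"
    using M by linarith
  then have "\<beta> < \<alpha> * real K powr (a - b)"
    using assms by (simp add: field_simps)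
  then have "\<beta> * real K powr b < \<alpha> * real K powr (a - b) * real K powr b"
    using K0 by (intro mult_strict_right_mono) auto
  also have "\<dots> = \<alpha> * real K powr a"
    by (simp add: mult.assoc flip: powr_add)
  finally show ?thesis
    using K0 by blast
qed

theorem proposition2p7:
  fixes t :: real and p q :: ennreal and g :: "real^'n::finite \<Rightarrow> complex"
  assumes "t \<noteq> 0"
    and "1 \<le> p" and "1 \<le> q" and "p \<noteq> q"
    and "g \<in> schwartz_class" and "g \<noteq> (\<lambda>_. 0)"
  shows "\<not> (\<exists>C::real. C > 0 \<and>
           (\<forall>f\<in>schwartz_class.
              wiener_amalgam_norm g p q
                (fourier_multiplier
                   (\<lambda>\<xi>. exp (of_real pi * \<i> * of_real t * of_real ((norm \<xi>)\<^sup>2))) f)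
              \<le> ennreal C * wiener_amalgam_norm g p q f))"
proof
  assume "\<exists>C::real. C > 0 \<and>
           (\<forall>f\<in>schwartz_class.
              wiener_amalgam_norm g p q
                (fourier_multiplier
                   (\<lambda>\<xi>. exp (of_real pi * \<i> * of_real t * of_real ((norm \<xi>)\<^sup>2))) f)
              \<le> ennreal C * wiener_amalgam_norm g p q f)"
  then obtain B where B: "0 < B" "\<And>f. f \<in> schwartz_class \<Longrightarrow>
      wiener_amalgam_norm g p q (\<lambda>x. LINT \<xi>|lborel. ch (x \<bullet> \<xi>) * (chirp t \<xi> * fourier_transform f \<xi>))
        \<le> ennreal B * wiener_amalgam_norm g p q f"
    unfolding fourier_multiplier_eq by blast
  note g = assms(5)
  obtain C where C: "0 < C" "\<And>z \<zeta>. norm (stft g g z \<zeta>) \<le> C * decay z * decay \<zeta>"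
    using stft_decay[OF g] by blast
  obtain z0 c r where c: "0 < c" "0 < r"
      "\<And>z \<zeta>. z \<in> ball z0 r \<Longrightarrow> \<zeta> \<in> ball 0 r \<Longrightarrow> 2 * c \<le> norm (amb t g z \<zeta>)"
    using amb_lower_bound[OF g assms(6)] by blast
  obtain D where D: "0 \<le> D" "\<And>z \<zeta> i. norm (amb t g z \<zeta>) \<le> D / (1 + (\<zeta> $ i / 2)\<^sup>2)"
    using norm_amb_le[OF g] by blast
  define I where "I = (LINT y|lborel. decay (y :: real^'n))"
  have I: "0 < I"
    unfolding I_def by (rule integral_decay_pos)
  define b where "b = measure lborel (ball (0::real^'n) r)"
  have b: "0 < b"
    unfolding b_def using c(2) by (simp add: content_ball_pos)
  define i :: 'n where "i = undefined"
  \<comment> \<open>The entries without 1/|t| separate the pieces in frequency and control their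
    interference. Those with 1/|t| separate them in time, where the spacing is only |t| N; here
    \<open>t \<noteq> 0\<close> is essential, as for \<open>t = 0\<close> the multiplier moves
    nothing.\<close>
  define N where "N K = Max {1, real K, 2 * r, 16 * D * real K / c, 1 / \<bar>t\<bar>, real K / \<bar>t\<bar>, 2 * r / \<bar>t\<bar>}" for K :: nat
  have N: "1 \<le> N K" "real K \<le> N K" "2 * r \<le> N K" "16 * D * real K / c \<le> N K" for K
    unfolding N_def by (rule Max_ge; simp)+
  have N': "1 \<le> \<bar>t * N K\<bar>" "real K \<le> \<bar>t * N K\<bar>" "2 * r \<le> \<bar>t * N K\<bar>" for K
  proof -
    have "1 / \<bar>t\<bar> \<le> N K" "real K / \<bar>t\<bar> \<le> N K" "2 * r / \<bar>t\<bar> \<le> N K"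
      unfolding N_def by (rule Max_ge; simp)+
    then show "1 \<le> \<bar>t * N K\<bar>" "real K \<le> \<bar>t * N K\<bar>" "2 * r \<le> \<bar>t * N K\<bar>"
      using assms(1) N(1)[of K] by (simp_all add: abs_mult field_simps)
  qed
  define \<eta> where "\<eta> K k = (N K * real k) *\<^sub>R axis i (1::real)" for K k :: nat
  \<comment> \<open>The two test families in one: \<open>s = 0\<close> gives pure modulations, while
    \<open>s = t\<close> places the pieces so that the multiplier carries all of them back to a
    common time.\<close>
  define f where "f s K y = (\<Sum>k<K. ch (\<eta> K k \<bullet> y) * g (y - s *\<^sub>R \<eta> K k))" for s K y
  define T where "T s K = (\<lambda>x. LINT \<xi>|lborel. ch (x \<bullet> \<xi>) * (chirp t \<xi> * fourier_transform (f s K) \<xi>))" for s K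
  have T_le: "wiener_amalgam_norm g p q (T s K) \<le> ennreal B * wiener_amalgam_norm g p q (f s K)" for s K
    unfolding T_def by (rule B(2)) (unfold f_def [abs_def], rule sum_shifts_in_schwartz[OF g])
  have T_ge: "ennreal c \<le> ennreal (norm (stft g (T s K) z \<zeta>))"
    if "k < K" "z + t *\<^sub>R \<eta> K k - s *\<^sub>R \<eta> K k \<in> ball z0 r" "\<zeta> - \<eta> K k \<in> ball 0 r" for s K z \<zeta> k
  proof (rule ennreal_leI)
    show "c \<le> norm (stft g (T s K) z \<zeta>)"
      using stft_multiplier_lower_bound[OF g c(1) c(3) D N(1) N(3) N(4) that(1), where i=i
          and x="\<lambda>k. s *\<^sub>R \<eta> K k" and z=z and \<zeta>=\<zeta>] that(2,3)
      unfolding T_def f_def [abs_def] \<eta>_def by blast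
  qed
  have em1: "emeasure lborel (ball w r) = ennreal b" for w :: "real^'n"
    unfolding b_def by (rule emeasure_ball_content[OF c(2)])
  have em: "emeasure lborel (\<Union>k<K. ball (w + (s * N K * real k) *\<^sub>R axis i 1) r) = ennreal (real K * b)"
    if "2 * r \<le> \<bar>s * N K\<bar>" for K and w :: "real^'n" and s
    unfolding b_def by (rule emeasure_separated_balls[OF c(2) that])
  \<comment> \<open>Both cases end in the same way: a lower bound with the larger power of
    \<open>K\<close> against an upper bound with the smaller one.\<close>
  have combine: False
    if le: "\<And>K. 0 < K \<Longrightarrow> ennreal (c * u * real K powr a) \<le> ennreal B * ennreal (v * real K powr a')"
      and "0 < u" "a' < a" for u v a a' :: real
  proof -
    have "0 < c * u"
      using c(1) \<open>0 < u\<close> by simp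
    then obtain K where K: "0 < K" "(B * v) * real K powr a' < (c * u) * real K powr a"
      using powr_unbounded[OF \<open>a' < a\<close>] by blast
    have "ennreal (c * u * real K powr a) \<le> ennreal ((B * v) * real K powr a')"
      using le[OF K(1)] B(1) by (simp add: ennreal_mult' [symmetric] mult.assoc)
    moreover have "0 < c * u * real K powr a"
      using \<open>0 < c * u\<close> K(1) by simp
    ultimately show False
      using K(2) by (metis ennreal_le_iff2 not_le)
  qed
  show False
  proof (cases "q < p")
    case True
    have bound: "ennreal (c * (b powr recip p * b powr recip q) * real K powr recip q)
        \<le> ennreal B * ennreal ((C * 5 * I powr recip p * I powr recip q) * real K powr recip p)"
      if K: "0 < K" for K
    proof -
      \<comment> \<open>The centres are \<open>z0 - t *\<^sub>R \<eta> K k\<close>, the times to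
        which the multiplier moves the modulated pieces.\<close>
      let ?E = "\<Union>k<K. ball (z0 + (- t * N K * real k) *\<^sub>R axis i 1) r"
      have "ennreal ((c * b powr recip p) * (real K * b) powr recip q) \<le> wiener_amalgam_norm g p q (T 0 K)"
        unfolding wiener_amalgam_norm_def
      proof (rule Lp_norm_ge[OF assms(3)])
        show "emeasure lborel ?E = ennreal (real K * b)"
          using N'(3)[of K] by (intro em) simp
        fix z assume "z \<in> ?E"
        then obtain k where k: "k < K" "z + t *\<^sub>R \<eta> K k - 0 *\<^sub>R \<eta> K k \<in> ball z0 r"
          by (auto simp: \<eta>_def dist_norm algebra_simps)
        show "ennreal (c * b powr recip p) \<le> Lp_norm p (\<lambda>\<zeta>. ennreal (norm (stft g (T 0 K) z \<zeta>)))"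
        \<comment> \<open>Over the time of the k-th piece only the frequency ball around
          \<open>\<eta> K k\<close> is used, so the inner bound is free of \<open>K\<close>; the
          outer norm over \<open>?E\<close> contributes \<open>K\<close>.\<close>
        proof (rule Lp_norm_ge[OF assms(2) _ em1])
          fix \<zeta> assume "\<zeta> \<in> ball (\<eta> K k) r"
          then show "ennreal c \<le> ennreal (norm (stft g (T 0 K) z \<zeta>))"
            by (intro T_ge[OF k]) (simp add: dist_norm norm_minus_commute)
        qed (use b c in auto)
      qed (use b c K in auto)
      also have "\<dots> \<le> ennreal B * wiener_amalgam_norm g p q (f 0 K)"
        by (rule T_le)
      also have "\<dots> \<le> ennreal B * ennreal (C * 5 * (real K * I) powr recip p * I powr recip q)"
      proof (rule mult_left_mono)
        show "wiener_amalgam_norm g p q (f 0 K) \<le> ennreal (C * 5 * (real K * I) powr recip p * I powr recip q)"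
        using amalgam_norm_modulations_le[OF g _ C(2) assms(2,3) _ K N(1,2), where i=i] C(1) True
        unfolding f_def [abs_def] \<eta>_def I_def by (simp add: top.not_eq_extremum order_less_le_trans)
      qed simp
      finally show ?thesis
        using b I by (simp add: powr_mult mult_ac)
    qed
    moreover have "recip p < recip q"
      by (rule recip_strict_antimono[OF assms(3) True])
    ultimately show False
      using b by (intro combine[OF bound]) auto
  next
    case False
    then have pq: "p < q"
      using assms(4) by (simp add: not_less)
    have bound: "ennreal (c * (b powr recip p * b powr recip q) * real K powr recip p)
        \<le> ennreal B * ennreal ((C * 5 * I powr recip p * I powr recip q) * real K powr recip q)"
      if K: "0 < K" for K
    proof -
      \<comment> \<open>Here the union lies in frequency: over every \<open>z\<close> in the one
        ball around \<open>z0\<close> all \<open>K\<close> pieces are visible, so \<open>K\<close>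
        comes from the inner norm. The neutral \<open>0 +\<close> and \<open>1 *\<close> fit the
        pattern of \<open>em\<close>.\<close>
      let ?E = "\<Union>k<K. ball (0 + (1 * N K * real k) *\<^sub>R axis i (1::real)) r"
      have "ennreal ((c * (real K * b) powr recip p) * b powr recip q) \<le> wiener_amalgam_norm g p q (T t K)"
        unfolding wiener_amalgam_norm_def
      proof (rule Lp_norm_ge[OF assms(3) _ em1])
        fix z assume z: "z \<in> ball z0 r"
        show "ennreal (c * (real K * b) powr recip p) \<le> Lp_norm p (\<lambda>\<zeta>. ennreal (norm (stft g (T t K) z \<zeta>)))"
        proof (rule Lp_norm_ge[OF assms(2)])
          show "emeasure lborel ?E = ennreal (real K * b)"
            using N(1,3)[of K] by (intro em) simp
          fix \<zeta> assume "\<zeta> \<in> ?E"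
          then obtain k where k: "k < K" "\<zeta> - \<eta> K k \<in> ball 0 r"
            by (auto simp: \<eta>_def dist_norm norm_minus_commute)
          then show "ennreal c \<le> ennreal (norm (stft g (T t K) z \<zeta>))"
            using z by (intro T_ge[OF k(1) _ k(2)]) simp
        qed (use b c K in auto)
      qed (use b c in auto)
      also have "\<dots> \<le> ennreal B * wiener_amalgam_norm g p q (f t K)"
        by (rule T_le)
      also have "\<dots> \<le> ennreal B * ennreal (C * I powr recip p * 5 * (real K * I) powr recip q)"
      proof (rule mult_left_mono)
        show "wiener_amalgam_norm g p q (f t K) \<le> ennreal (C * I powr recip p * 5 * (real K * I) powr recip q)"
        using amalgam_norm_shifts_le[OF g _ C(2) assms(2) _ assms(3) K N'(1,2), where i=i] C(1) pq
        unfolding f_def [abs_def] \<eta>_def I_def by (simp add: less_top order_less_le_trans)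
      qed simp
      finally show ?thesis
        using b I by (simp add: powr_mult mult_ac)
    qed
    moreover have "recip q < recip p"
      by (rule recip_strict_antimono[OF assms(2) pq])
    ultimately show False
      using b by (intro combine[OF bound]) auto
  qed
qed

end
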